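(* Let $n\ge 2$ and $p>n$, let $x_1,\dots,x_N\in\mathbb{R}^n$ be distinct and $a_1,\dots,a_N\in\mathbb{R}$. Suppose $u\in \mathcal{D}^{1,p}(\mathbb{R}^n)$ minimizes $$\int_{\mathbb{R}^n}|Dv|^pdx$$ among all $v\in\mathcal{D}^{1,p}(\mathbb{R}^n)$ satisfying $v(x_i)=a_i$ for $i=1,\dots,N$. Then $$\min_{1\le i\le N}a_i\le u(x)\le \max_{1\le i\le N}a_i$$ for each $x\in \mathbb{R}^n$. Moreover, if not all of the $a_i$ are identical, $$\min_{1\le i\le N}a_i< u(x)< \max_{1\le i\le N}a_i$$ for each $x\in \mathbb{R}^n\setminus\{x_1,\dots, x_N\}$.
   Context: $\mathcal{D}^{1,p}(\mathbb{R}^n)=\{u\in L^1_{\mathrm{loc}}(\mathbb{R}^n): u_{x_i}\in L^p(\mathbb{R}^n)\text{ for } i=1,\dots,n\}$ (weak derivatives). Since $p>n$, each element is identified with its continuous representative, so point values are meaningful. The minimizer $u$ satisfies the constraints $u(x_i)=a_i$. *)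

theory Defs
  imports "HOL-Analysis.Analysis"
begin

definition partial_deriv :: "'n::finite \<Rightarrow> (real^'n \<Rightarrow> real) \<Rightarrow> real^'n \<Rightarrow> real" where
  "partial_deriv i \<phi> x = frechet_derivative \<phi> (at x) (axis i 1)"

primrec Ck :: "nat \<Rightarrow> (real^'n::finite \<Rightarrow> real) \<Rightarrow> bool" where
  "Ck 0 \<phi> \<longleftrightarrow> continuous_on UNIV \<phi>"
| "Ck (Suc k) \<phi> \<longleftrightarrow> (\<forall>x. \<phi> differentiable (at x)) \<and> (\<forall>i. Ck k (partial_deriv i \<phi>))"

definition test_function :: "(real^'n::finite \<Rightarrow> real) \<Rightarrow> bool" where
  "test_function \<phi> \<longleftrightarrow> (\<forall>k. Ck k \<phi>) \<and> compact (closure {x. \<phi> x \<noteq> 0})"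

definition L1_loc :: "(real^'n::finite \<Rightarrow> real) set" where
  "L1_loc = {u. \<forall>K. compact K \<longrightarrow> set_integrable lebesgue K u}"

definition Lp :: "real \<Rightarrow> (real^'n::finite \<Rightarrow> real) set" where
  "Lp p = {g \<in> borel_measurable lebesgue. integrable lebesgue (\<lambda>x. \<bar>g x\<bar> powr p)}"

definition has_weak_partial ::
    "(real^'n::finite \<Rightarrow> real) \<Rightarrow> 'n \<Rightarrow> (real^'n \<Rightarrow> real) \<Rightarrow> bool" where
  "has_weak_partial u i g \<longleftrightarrow> u \<in> L1_loc \<and> g \<in> L1_loc \<and>
     (\<forall>\<phi>. test_function \<phi> \<longrightarrow>
        (LINT x|lebesgue. u x * partial_deriv i \<phi> x) = - (LINT x|lebesgue. g x * \<phi> x))"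

(* Weak derivatives are unique only up to a null set; one version is chosen,
   and the integrals below do not depend on the choice. *)
definition weak_partial :: "'n::finite \<Rightarrow> (real^'n \<Rightarrow> real) \<Rightarrow> real^'n \<Rightarrow> real" where
  "weak_partial i u = (SOME g. has_weak_partial u i g)"

definition weak_gradient :: "(real^'n::finite \<Rightarrow> real) \<Rightarrow> real^'n \<Rightarrow> real^'n" where
  "weak_gradient u x = (\<chi> i. weak_partial i u x)"

definition D1p :: "real \<Rightarrow> (real^'n::finite \<Rightarrow> real) set" where
  "D1p p = {u \<in> L1_loc. \<forall>i. \<exists>g \<in> Lp p. has_weak_partial u i g}"

(* For p > n every class in D1p has exactly one continuous representative.  Point values
   refer to that representative, so elements are taken to be continuous functions. *)
definition D1p_cont :: "real \<Rightarrow> (real^'n::finite \<Rightarrow> real) set" where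
  "D1p_cont p = {u \<in> D1p p. continuous_on UNIV u}"

definition energy :: "real \<Rightarrow> (real^'n::finite \<Rightarrow> real) \<Rightarrow> real" where
  "energy p v = (LINT x|lebesgue. norm (weak_gradient v x) powr p)"

definition admissible ::
    "real \<Rightarrow> nat \<Rightarrow> (nat \<Rightarrow> real^'n::finite) \<Rightarrow> (nat \<Rightarrow> real) \<Rightarrow> (real^'n \<Rightarrow> real) set" where
  "admissible p N x a = {v \<in> D1p_cont p. \<forall>i\<in>{1..N}. v (x i) = a i}"

definition is_minimizer ::
    "real \<Rightarrow> nat \<Rightarrow> (nat \<Rightarrow> real^'n::finite) \<Rightarrow> (nat \<Rightarrow> real) \<Rightarrow> (real^'n \<Rightarrow> real) \<Rightarrow> bool" where
  "is_minimizer p N x a u \<longleftrightarrow>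
     u \<in> admissible p N x a \<and> (\<forall>v \<in> admissible p N x a. energy p u \<le> energy p v)"

end

theory Submission
  imports Defs
begin

text \<open>Upper bound, with \<open>M\<close> the maximum of the \<open>a\<^sub>i\<close>. Let \<open>G\<close> be the Huber function, which is convex with
  derivative \<open>s\<close> in \<open>[0,1]\<close> and vanishes exactly on the nonpositive reals. If \<open>u \<le> h\<close> at every \<open>x\<^sub>i\<close>, then
  \<open>u - G (u - h)\<close> is a competitor with gradient \<open>(1 - \<theta>) \<nabla>u + \<theta> \<nabla>h\<close>, where \<open>\<theta> = s (u - h)\<close>; by
  convexity \<open>\<integral>\<theta> \<bar>\<nabla>u\<bar>\<^sup>p \<le> \<integral>\<theta> \<bar>\<nabla>h\<bar>\<^sup>p\<close>. With \<open>h = M\<close> this makes \<open>G (u - M)\<close> constant, hence zero.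

  For strictness, suppose \<open>u = M\<close> at some point other than the \<open>x\<^sub>i\<close> without \<open>u\<close> being equal to \<open>M\<close> near it.
  Then some ball with centre \<open>c\<close>, whose closure meets \<open>{u = M}\<close> in a single point \<open>z\<close> different from all \<open>x\<^sub>i\<close>,
  has a slightly larger concentric ball such that \<open>h = M + \<epsilon> ln (\<bar>y - c\<bar> / R')\<close>, \<open>R'\<close> being the larger radius, is
  below \<open>u\<close> at \<open>z\<close> and above \<open>u\<close> away from \<open>z\<close>. As \<open>p > n\<close>, \<open>h\<close> is a strict supersolution away
  from \<open>c\<close>; testing this with \<open>G (u - h)\<close> and using the tangent inequality for \<open>\<bar>\<cdot>\<bar>\<^sup>p\<close> contradicts
  the estimate above. Since the complement of finitely many points is connected for \<open>n \<ge> 2\<close>, the set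
  \<open>{u = M}\<close> contains no other points.

  All calculus of weak derivatives rests on the increments \<open>u (x + t e\<^sub>i) - u x\<close> of the continuous
  representative, paired with continuous functions of compact support.\<close>

section \<open>Test functions\<close>

lemma partial_deriv_eq:
  "(\<phi> has_derivative D) (at x) \<Longrightarrow> partial_deriv i \<phi> x = D (axis i 1)"
  unfolding partial_deriv_def by (metis frechet_derivative_at)

lemma differentiable_has_derivative:
  "f differentiable (at x) \<Longrightarrow> (f has_derivative frechet_derivative f (at x)) (at x)"
  by (simp add: frechet_derivative_works)

lemma partial_deriv_add:
  assumes "f differentiable (at x)" "g differentiable (at x)"
  shows "partial_deriv i (\<lambda>x. f x + g x) x = partial_deriv i f x + partial_deriv i g x"
  using partial_deriv_eq[OF has_derivative_add[OF assms[THEN differentiable_has_derivative]]]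
  by (simp add: partial_deriv_def)

lemma partial_deriv_mult:
  fixes f g :: "real^'n::finite \<Rightarrow> real"
  assumes "f differentiable (at x)" "g differentiable (at x)"
  shows "partial_deriv i (\<lambda>x. f x * g x) x = f x * partial_deriv i g x + partial_deriv i f x * g x"
  using partial_deriv_eq[OF has_derivative_mult[OF assms[THEN differentiable_has_derivative]]]
  by (simp add: partial_deriv_def)

lemma partial_deriv_bounded_linear:
  "bounded_linear f \<Longrightarrow> partial_deriv i f x = f (axis i 1)"
  by (intro partial_deriv_eq bounded_linear_imp_has_derivative)

lemma partial_deriv_compose:
  fixes Q :: "real^'n::finite \<Rightarrow> real"
  assumes "(F has_real_derivative F') (at (Q x))" "Q differentiable (at x)"
  shows "(\<lambda>x. F (Q x)) differentiable (at x)"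
    and "partial_deriv i (\<lambda>x. F (Q x)) x = F' * partial_deriv i Q x"
proof -
  have "((\<lambda>x. F (Q x)) has_derivative (\<lambda>h. F' * frechet_derivative Q (at x) h)) (at x)"
    using has_derivative_compose[OF differentiable_has_derivative[OF assms(2)]]
      assms(1)[unfolded has_field_derivative_def] by (auto simp: o_def)
  then show "(\<lambda>x. F (Q x)) differentiable (at x)"
    and "partial_deriv i (\<lambda>x. F (Q x)) x = F' * partial_deriv i Q x"
    by (auto simp: differentiable_def partial_deriv_eq) (simp add: partial_deriv_def)
qed

lemma Ck_imp_continuous: "Ck k f \<Longrightarrow> continuous_on UNIV f"
  by (cases k) (auto simp: continuous_on_eq_continuous_at differentiable_imp_continuous_within)

lemma Ck_Suc_imp_Ck: "Ck (Suc k) f \<Longrightarrow> Ck k f"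
proof (induction k arbitrary: f)
  case 0
  then show ?case using Ck_imp_continuous[OF 0] by simp
next
  case (Suc k)
  then show ?case by (metis Ck.simps(2))
qed

lemma Ck_const: "Ck k (\<lambda>x. c)"
proof (induction k arbitrary: c)
  case (Suc k)
  have "partial_deriv i (\<lambda>x. c) = (\<lambda>x. 0)" for i :: 'a
    by (intro ext partial_deriv_eq) auto
  then show ?case using Suc by simp
qed auto

lemma Ck_add: "Ck k f \<Longrightarrow> Ck k g \<Longrightarrow> Ck k (\<lambda>x. f x + g x)"
proof (induction k arbitrary: f g)
  case (Suc k)
  then have "partial_deriv i (\<lambda>x. f x + g x) = (\<lambda>x. partial_deriv i f x + partial_deriv i g x)" for i
    by (intro ext partial_deriv_add) auto
  with Suc show ?case by auto
qed (auto intro: continuous_intros)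

lemma Ck_mult: "Ck k f \<Longrightarrow> Ck k g \<Longrightarrow> Ck k (\<lambda>x. f x * g x)"
proof (induction k arbitrary: f g)
  case (Suc k)
  then have "partial_deriv i (\<lambda>x. f x * g x) = (\<lambda>x. f x * partial_deriv i g x + partial_deriv i f x * g x)" for i
    by (intro ext partial_deriv_mult) auto
  moreover have "Ck k f" "Ck k g" using Suc.prems by (blast intro: Ck_Suc_imp_Ck)+
  ultimately show ?case using Suc by (auto intro!: Ck_add)
qed (auto intro: continuous_intros)

lemma Ck_bounded_linear: "bounded_linear f \<Longrightarrow> Ck k f"
proof (cases k)
  case 0
  assume "bounded_linear f" then show ?thesis using 0 by (simp add: linear_continuous_on)
next
  case (Suc j)
  assume f: "bounded_linear f"
  have "partial_deriv i f = (\<lambda>x. f (axis i 1))" for i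
    using partial_deriv_bounded_linear[OF f] by auto
  then show ?thesis using Suc f by (auto simp: Ck_const bounded_linear_imp_differentiable)
qed

lemma Ck_real_polynomial_function: "real_polynomial_function f \<Longrightarrow> Ck k f"
  by (induction rule: real_polynomial_function.induct)
     (auto simp: Ck_const Ck_add Ck_mult Ck_bounded_linear)

lemma partial_deriv_translate:
  "partial_deriv i (\<lambda>x. f (x - v)) x = partial_deriv i f (x - v)" if "f differentiable (at (x - v))"
proof -
  have "((\<lambda>x. f (x - v)) has_derivative frechet_derivative f (at (x - v))) (at x)"
    using has_derivative_compose[of "\<lambda>x. x - v" "\<lambda>h. h" x UNIV f] differentiable_has_derivative[OF that]
    by (auto intro: derivative_eq_intros simp: has_derivative_diff[OF has_derivative_ident has_derivative_const, simplified])
  from partial_deriv_eq[OF this] show ?thesis by (simp add: partial_deriv_def)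
qed

lemma Ck_translate: "Ck k f \<Longrightarrow> Ck k (\<lambda>x. f (x - v))"
proof (induction k arbitrary: f)
  case 0
  then show ?case by (auto intro!: continuous_on_compose2[of UNIV f] continuous_intros)
next
  case (Suc k)
  have "(\<lambda>x. f (x - v)) differentiable (at x)" for x
    using Suc.prems differentiable_chain_at[of "\<lambda>x. x - v" x f] by (auto simp: o_def)
  moreover have "partial_deriv i (\<lambda>x. f (x - v)) = (\<lambda>x. partial_deriv i f (x - v))" for i
    using Suc.prems by (intro ext partial_deriv_translate) auto
  ultimately show ?case using Suc by auto
qed

section \<open>A smooth bump and uniform approximation by test functions\<close>

definition exp_bump :: "real poly \<Rightarrow> real \<Rightarrow> real" where
  "exp_bump q t = (if t > 0 then poly q (1 / t) * exp (- 1 / t) else 0)"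

lemma poly_exp_tendsto_0: "((\<lambda>s. poly q s * exp (- s)) \<longlongrightarrow> 0) at_top" for q :: "real poly"
proof -
  have "((\<lambda>s. \<Sum>i\<le>degree q. coeff q i * (s ^ i / exp s)) \<longlongrightarrow> (\<Sum>i\<le>degree q. coeff q i * 0)) at_top"
    by (intro tendsto_sum tendsto_mult tendsto_const tendsto_power_div_exp_0)
  then show ?thesis
    by (simp add: poly_altdef sum_distrib_right sum_divide_distrib exp_minus field_simps)
qed

text \<open>With s = 1/t the derivative of q(s) exp(-s) in t is s^2 (q - q')(s) exp(-s), because
  ds/dt = -s^2. The polynomial parameter thus closes the family under differentiation. At t = 0 the
  right difference quotient is s q(s) exp(-s), which tends to 0 as s grows.\<close>

lemma DERIV_exp_bump:
  "(exp_bump q has_real_derivative exp_bump ([:0, 0, 1:] * (q - pderiv q)) t) (at t)"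
proof -
  consider "t > 0" | "t < 0" | "t = 0" by linarith
  then show ?thesis
  proof cases
    case 1
    have "((\<lambda>t. poly q (1 / t) * exp (- 1 / t)) has_real_derivative
        exp_bump ([:0, 0, 1:] * (q - pderiv q)) t) (at t)"
      using 1 by (auto intro!: derivative_eq_intros DERIV_chain2[OF poly_DERIV]
          simp: exp_bump_def power2_eq_square algebra_simps)
    then show ?thesis
      by (rule has_field_derivative_transform_within_open[of _ _ _ "{0<..}"])
         (use 1 in \<open>auto simp: exp_bump_def\<close>)
  next
    case 2
    then have "exp_bump ([:0, 0, 1:] * (q - pderiv q)) t = 0" by (simp add: exp_bump_def)
    moreover have "(exp_bump q has_real_derivative 0) (at t)"
      by (rule has_field_derivative_transform_within_open[of "\<lambda>_. 0" _ _ "{..<0}"])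
         (use 2 in \<open>auto simp: exp_bump_def\<close>)
    ultimately show ?thesis by simp
  next
    case 3
    have "((\<lambda>h. exp_bump q h / h) \<longlongrightarrow> 0) (at_right 0)"
    proof -
      have "((\<lambda>h. poly (pCons 0 q) (inverse h) * exp (- inverse h)) \<longlongrightarrow> 0) (at_right 0)"
        by (rule filterlim_compose[OF poly_exp_tendsto_0 filterlim_inverse_at_top_right])
      then show ?thesis
        by (rule Lim_transform_eventually)
           (auto simp: exp_bump_def field_simps eventually_at_right_less intro!: eventually_mono[OF eventually_at_right_less])
    qed
    moreover have "((\<lambda>h. exp_bump q h / h) \<longlongrightarrow> 0) (at_left 0)"
      by (rule Lim_transform_eventually[OF tendsto_const])
         (auto simp: exp_bump_def eventually_at_filter)
    ultimately have "((\<lambda>h. exp_bump q h / h) \<longlongrightarrow> 0) (at 0)"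
      by (simp add: filterlim_at_split)
    then show ?thesis using 3 by (simp add: DERIV_def exp_bump_def)
  qed
qed

text \<open>The induction runs over all \<open>q\<close> at once, since each derivative replaces
  \<open>q\<close> by another polynomial.\<close>

lemma Ck_exp_bump_compose:
  assumes "\<And>k. Ck k Q"
  shows "Ck k (\<lambda>x. exp_bump q (Q x))"
proof (induction k arbitrary: q)
  case 0
  have "isCont (exp_bump q) t" for t using DERIV_exp_bump DERIV_isCont by blast
  then show ?case using Ck_imp_continuous[OF assms]
    by (auto intro: continuous_on_compose2[of UNIV "exp_bump q" UNIV Q] continuous_at_imp_continuous_on)
next
  case (Suc k)
  have Q: "Q differentiable (at x)" for x using assms[of "Suc 0"] by simp
  have Q': "Ck k (partial_deriv i Q)" for i using assms[of "Suc k"] by simp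
  show ?case
    using partial_deriv_compose[OF DERIV_exp_bump Q] Suc Q'
    by (auto simp: partial_deriv_compose(2)[OF DERIV_exp_bump Q, abs_def] intro!: Ck_mult)
qed

text \<open>The squared norm is a polynomial in the coordinates, so smoothness holds at the origin
  as well.\<close>

definition bump :: "real \<Rightarrow> real^'n::finite \<Rightarrow> real" where
  "bump R x = exp_bump 1 (R\<^sup>2 - (norm x)\<^sup>2)"

lemma Ck_bump: "Ck k (bump R :: real^'n::finite \<Rightarrow> real)"
proof -
  have "real_polynomial_function (\<lambda>x::real^'n. R\<^sup>2 + (-1) * (\<Sum>i\<in>UNIV. x $ i * x $ i))"
    by (intro real_polynomial_function.intros real_polynomial_function_sum finite_class.finite_UNIV
        bounded_linear_vec_nth)
  moreover have "(norm x)\<^sup>2 = (\<Sum>i\<in>UNIV. x $ i * x $ i)" for x :: "real^'n"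
    unfolding power2_norm_eq_inner by (simp add: inner_vec_def)
  ultimately have "real_polynomial_function (\<lambda>x::real^'n. R\<^sup>2 - (norm x)\<^sup>2)"
    by simp
  then show ?thesis unfolding bump_def[abs_def]
    by (intro Ck_exp_bump_compose Ck_real_polynomial_function)
qed

lemma bump_nonneg: "bump R x \<ge> 0" and bump_le_1: "bump R x \<le> 1"
  by (auto simp: bump_def exp_bump_def)

lemma bump_eq_0: "R \<ge> 0 \<Longrightarrow> norm x \<ge> R \<Longrightarrow> bump R x = 0"
  by (simp add: bump_def exp_bump_def not_less power_mono)

text \<open>The lower bound on the smaller ball allows division by the bump there.\<close>

lemma bump_ge:
  assumes "0 \<le> R" "R < S"
  shows "\<exists>m>0. \<forall>x. norm x \<le> R \<longrightarrow> m \<le> bump S x"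
proof (intro exI[of _ "exp (- 1 / (S\<^sup>2 - R\<^sup>2))"] conjI allI impI)
  fix x :: "real^'n" assume x: "norm x \<le> R"
  have 1: "S\<^sup>2 - R\<^sup>2 > 0" using assms by (simp add: power_strict_mono)
  have 2: "S\<^sup>2 - R\<^sup>2 \<le> S\<^sup>2 - (norm x)\<^sup>2" using x by (simp add: power_mono)
  show "exp (- 1 / (S\<^sup>2 - R\<^sup>2)) \<le> bump S x"
    using 1 2 by (auto simp: bump_def exp_bump_def frac_le)
qed auto

lemma test_functionI:
  assumes "\<And>k. Ck k f" "\<And>x. norm x > R \<Longrightarrow> f x = 0"
  shows "test_function f"
proof -
  have "{x. f x \<noteq> 0} \<subseteq> cball 0 R" using assms(2) by force
  then have "bounded {x. f x \<noteq> 0}" by (meson bounded_cball bounded_subset)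
  then show ?thesis using assms(1) by (simp add: test_function_def compact_closure)
qed

lemma test_functionD:
  assumes "test_function f"
  shows "\<And>k. Ck k f" "\<exists>R>0. \<forall>x. norm x > R \<longrightarrow> f x = 0"
proof -
  show "Ck k f" for k using assms by (simp add: test_function_def)
  have "bounded {x. f x \<noteq> 0}"
    using assms by (auto simp: test_function_def intro: bounded_subset[OF compact_imp_bounded closure_subset])
  then obtain R where "R > 0" "\<forall>x\<in>{x. f x \<noteq> 0}. norm x \<le> R" by (meson bounded_pos)
  then show "\<exists>R>0. \<forall>x. norm x > R \<longrightarrow> f x = 0" by (intro exI[of _ R]) force
qed

text \<open>In place of a convolution, divide \<open>\<psi>\<close> by a bump that is positive on
  its support, approximate the quotient by a polynomial on the larger ball (Stone-Weierstrass), and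
  multiply back. The bump is at most 1, so the error does not grow.\<close>

lemma test_function_approx:
  fixes \<psi> :: "real^'n::finite \<Rightarrow> real"
  assumes cont: "continuous_on UNIV \<psi>" and zero: "\<And>x. norm x > R \<Longrightarrow> \<psi> x = 0"
    and "R \<ge> 0" "e > 0"
  obtains \<eta> where "test_function \<eta>" "\<And>x. \<bar>\<psi> x - \<eta> x\<bar> \<le> e" "\<And>x. norm x > R + 1 \<Longrightarrow> \<eta> x = 0"
proof -
  obtain m where m: "m > 0" "\<And>x::real^'n. norm x \<le> R \<Longrightarrow> m \<le> bump (R + 1) x"
    using bump_ge[of R "R + 1"] assms(3) by force
  \<comment> \<open>The floor \<open>m\<close> keeps the denominator positive everywhere. It changes
    the bump only where the norm exceeds \<open>R\<close>, and there \<open>\<psi>\<close> is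
    zero.\<close>
  define r where "r x = \<psi> x / max (bump (R + 1) x) m" for x
  have cb: "continuous_on UNIV (bump (R + 1) :: real^'n \<Rightarrow> real)" by (rule Ck_imp_continuous[OF Ck_bump[of 0]])
  have "continuous_on UNIV r" unfolding r_def
    using m(1) by (intro continuous_intros cont cb) (auto simp: max_def)
  then obtain P where P: "real_polynomial_function P" "\<And>x. x \<in> cball 0 (R + 1) \<Longrightarrow> \<bar>r x - P x\<bar> < e"
    using Stone_Weierstrass_real_polynomial_function[of "cball 0 (R + 1)" r e] assms(4)
    by (auto intro: continuous_on_subset)
  define \<eta> where "\<eta> x = P x * bump (R + 1) x" for x
  have 0: "\<eta> x = 0" if "norm x > R + 1" for x
    using that assms(3) by (simp add: \<eta>_def bump_eq_0)
  show thesis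
  proof (rule that[of \<eta>])
    show "test_function \<eta>"
      by (rule test_functionI[OF _ 0]) (auto simp: \<eta>_def[abs_def] intro!: Ck_mult Ck_bump Ck_real_polynomial_function[OF P(1)])
    fix x
    have \<psi>: "\<psi> x = r x * bump (R + 1) x"
      using m(1) m(2)[of x] zero[of x] by (cases "norm x \<le> R") (auto simp: r_def max_absorb1)
    show "\<bar>\<psi> x - \<eta> x\<bar> \<le> e"
    proof (cases "norm x \<le> R + 1")
      case True
      have "\<bar>\<psi> x - \<eta> x\<bar> = \<bar>r x - P x\<bar> * bump (R + 1) x"
        using bump_nonneg[of "R + 1" x] by (simp add: \<psi> \<eta>_def abs_mult left_diff_distrib[symmetric])
      also have "\<dots> \<le> e * 1"
        using P(2)[of x] True bump_nonneg[of "R + 1" x] bump_le_1[of "R + 1" x] by (intro mult_mono) auto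
      finally show ?thesis by simp
    qed (use 0 zero[of x] assms in auto)
  qed (rule 0)
qed

section \<open>Weak derivatives\<close>

lemma borel_measurable_lebesgue_continuous [intro]:
  "continuous_on UNIV f \<Longrightarrow> (f :: real^'n::finite \<Rightarrow> real) \<in> borel_measurable lebesgue"
  by (intro measurable_completion) (simp add: borel_measurable_continuous_onI)

lemma bounded_of_continuous_compact_support:
  fixes \<psi> :: "real^'n::finite \<Rightarrow> real"
  assumes "continuous_on UNIV \<psi>" "\<And>x. norm x > R \<Longrightarrow> \<psi> x = 0"
  obtains S where "S > 0" "\<And>x. \<bar>\<psi> x\<bar> \<le> S"
proof -
  have "bounded (\<psi> ` cball 0 R)"
    by (rule compact_imp_bounded[OF compact_continuous_image[OF continuous_on_subset[OF assms(1)]]]) auto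
  then obtain S where S: "S > 0" "\<And>x. x \<in> cball 0 R \<Longrightarrow> \<bar>\<psi> x\<bar> \<le> S" by (auto simp: bounded_pos)
  have "\<bar>\<psi> x\<bar> \<le> S" for x using S assms(2)[of x] by (cases "norm x \<le> R") auto
  then show thesis using S(1) that by blast
qed

lemma partial_deriv_eq_0_outside:
  fixes \<phi> :: "real^'n::finite \<Rightarrow> real"
  assumes "\<And>x. norm x > R \<Longrightarrow> \<phi> x = 0" "norm x > R"
  shows "partial_deriv i \<phi> x = 0"
proof -
  have "(\<phi> has_derivative (\<lambda>_. 0)) (at x)"
  proof (rule has_derivative_transform_within_open[of "\<lambda>_. 0"])
    show "open {x::real^'n. norm x > R}" by (intro open_Collect_less continuous_intros)
  qed (use assms in auto)
  then show ?thesis by (simp add: partial_deriv_eq)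
qed

lemma set_integrable_mult_continuous:
  fixes g h :: "real^'n::finite \<Rightarrow> real"
  assumes "set_integrable lebesgue K g" "compact K" "continuous_on UNIV h"
  shows "set_integrable lebesgue K (\<lambda>x. g x * h x)"
proof -
  have "bounded (h ` K)"
    by (rule compact_imp_bounded[OF compact_continuous_image[OF continuous_on_subset[OF assms(3)] assms(2)]]) simp
  then obtain B where B: "B > 0" "\<And>x. x \<in> K \<Longrightarrow> \<bar>h x\<bar> \<le> B" by (auto simp: bounded_pos)
  have int: "integrable lebesgue (\<lambda>x. indicator K x *\<^sub>R g x)"
    using assms by (simp add: set_integrable_def)
  show ?thesis unfolding set_integrable_def
  proof (rule Bochner_Integration.integrable_bound)
    show "integrable lebesgue (\<lambda>x. B * (indicator K x *\<^sub>R g x))"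
      using int by (rule integrable_mult_right)
    have "(\<lambda>x. (indicator K x *\<^sub>R g x) * h x) \<in> borel_measurable lebesgue"
      using int assms(3) by (intro borel_measurable_times) auto
    then show "(\<lambda>x. indicator K x *\<^sub>R (g x * h x)) \<in> borel_measurable lebesgue" by (simp add: mult.assoc)
    show "AE x in lebesgue. norm (indicator K x *\<^sub>R (g x * h x)) \<le> norm (B * (indicator K x *\<^sub>R g x))"
    proof (intro AE_I2)
      fix x
      have "\<bar>h x\<bar> * \<bar>g x\<bar> \<le> B * \<bar>g x\<bar>" if "x \<in> K" using B that by (intro mult_right_mono) auto
      then show "norm (indicator K x *\<^sub>R (g x * h x)) \<le> norm (B * (indicator K x *\<^sub>R g x))"
        using B by (auto simp: indicator_def abs_mult mult.commute)
    qed
  qed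
qed

lemma L1_locD: "g \<in> L1_loc \<Longrightarrow> compact K \<Longrightarrow> set_integrable lebesgue K g"
  by (simp add: L1_loc_def)

lemma continuous_in_L1_loc: "continuous_on UNIV f \<Longrightarrow> f \<in> L1_loc"
  unfolding L1_loc_def set_integrable_def mem_Collect_eq
proof (intro allI impI)
  fix K :: "(real^'a) set" assume f: "continuous_on UNIV f" and K: "compact K"
  have "integrable lborel (\<lambda>x. indicator K x *\<^sub>R f x)"
    by (rule borel_integrable_compact[OF K]) (rule continuous_on_subset[OF f], simp)
  then show "integrable lebesgue (\<lambda>x. indicator K x *\<^sub>R f x)"
    by (subst integrable_completion) auto
qed

lemma L1_loc_add: "f \<in> L1_loc \<Longrightarrow> g \<in> L1_loc \<Longrightarrow> (\<lambda>x. f x + g x) \<in> L1_loc"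
  by (auto simp: L1_loc_def)

lemma L1_loc_mult_continuous: "g \<in> L1_loc \<Longrightarrow> continuous_on UNIV h \<Longrightarrow> (\<lambda>x. g x * h x) \<in> L1_loc"
  by (simp add: L1_loc_def set_integrable_mult_continuous)

lemma L1_loc_measurable:
  fixes g :: "real^'n::finite \<Rightarrow> real"
  assumes "g \<in> L1_loc"
  shows "g \<in> borel_measurable lebesgue"
proof (rule borel_measurable_LIMSEQ_real)
  fix x :: "real^'n"
  have "\<forall>\<^sub>F n in sequentially. indicator (cball 0 (real n)) x *\<^sub>R g x = g x"
    using eventually_ge_at_top[of "nat \<lceil>norm x\<rceil>"]
    by eventually_elim (auto simp: indicator_def nat_le_iff ceiling_le_iff)
  then show "(\<lambda>n. indicator (cball 0 (real n)) x *\<^sub>R g x) \<longlonglongrightarrow> g x"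
    by (rule tendsto_eventually)
  show "(\<lambda>x. indicator (cball 0 (real n)) x *\<^sub>R g x) \<in> borel_measurable lebesgue" for n
    using L1_locD[OF assms, of "cball 0 (real n)"] by (auto simp: set_integrable_def)
qed

text \<open>The bound expresses continuity of the pairing under uniform convergence with a fixed
  support; it carries results from test functions over to continuous functions.\<close>

lemma
  fixes g \<psi> :: "real^'n::finite \<Rightarrow> real"
  assumes "g \<in> L1_loc" "continuous_on UNIV \<psi>" and zero: "\<And>x. norm x > R \<Longrightarrow> \<psi> x = 0"
  shows integrable_L1_loc_mult: "integrable lebesgue (\<lambda>x. g x * \<psi> x)"
    and integral_L1_loc_mult_bound: "(\<And>x. \<bar>\<psi> x\<bar> \<le> S) \<Longrightarrow>
      \<bar>LINT x|lebesgue. g x * \<psi> x\<bar> \<le> S * (LINT x:cball 0 R|lebesgue. \<bar>g x\<bar>)"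
proof -
  have eq: "(\<lambda>x. indicator (cball 0 R) x *\<^sub>R (g x * \<psi> x)) = (\<lambda>x. g x * \<psi> x)"
    using zero by (auto simp: indicator_def fun_eq_iff)
  show int: "integrable lebesgue (\<lambda>x. g x * \<psi> x)"
    using set_integrable_mult_continuous[OF L1_locD[OF assms(1)] _ assms(2), of "cball 0 R"]
    by (simp add: set_integrable_def eq[simplified])
  assume S: "\<And>x. \<bar>\<psi> x\<bar> \<le> S"
  have "integrable lebesgue (\<lambda>x. indicator (cball 0 R) x *\<^sub>R \<bar>g x\<bar>)"
    using set_integrable_abs[OF L1_locD[OF assms(1), of "cball 0 R"]] by (simp add: set_integrable_def)
  then have "\<bar>LINT x|lebesgue. g x * \<psi> x\<bar> \<le> (LINT x|lebesgue. S * (indicator (cball 0 R) x *\<^sub>R \<bar>g x\<bar>))"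
  proof (intro integral_abs_bound[THEN order_trans] integral_mono integrable_abs int integrable_mult_right)
    fix x
    have "\<bar>g x\<bar> * \<bar>\<psi> x\<bar> \<le> S * \<bar>g x\<bar>" using mult_right_mono[OF S[of x] abs_ge_zero[of "g x"]] by (simp add: mult.commute)
    then show "\<bar>g x * \<psi> x\<bar> \<le> S * (indicator (cball 0 R) x *\<^sub>R \<bar>g x\<bar>)"
      using zero[of x] by (auto simp: indicator_def abs_mult)
  qed
  then show "\<bar>LINT x|lebesgue. g x * \<psi> x\<bar> \<le> S * (LINT x:cball 0 R|lebesgue. \<bar>g x\<bar>)"
    by (simp add: set_lebesgue_integral_def)
qed

section \<open>The fundamental lemma of the calculus of variations: from smooth test functions
  through continuous ones to compact sets\<close>

lemma integral_test_zero_imp_continuous_zero: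
  fixes g \<psi> :: "real^'n::finite \<Rightarrow> real"
  assumes g: "g \<in> L1_loc" and 0: "\<And>\<phi>. test_function \<phi> \<Longrightarrow> (LINT x|lebesgue. g x * \<phi> x) = 0"
    and \<psi>: "continuous_on UNIV \<psi>" "\<And>x. norm x > R \<Longrightarrow> \<psi> x = 0" and R: "R \<ge> 0"
  shows "(LINT x|lebesgue. g x * \<psi> x) = 0"
proof -
  define I where "I = (LINT x:cball 0 (R+1)|lebesgue. \<bar>g x\<bar>)"
  have I: "I \<ge> 0" unfolding I_def set_lebesgue_integral_def by (intro integral_nonneg_AE) auto
  have "\<bar>LINT x|lebesgue. g x * \<psi> x\<bar> \<le> e * I" if "e > 0" for e
  proof -
    obtain \<eta> where \<eta>: "test_function \<eta>" "\<And>x. \<bar>\<psi> x - \<eta> x\<bar> \<le> e" "\<And>x. norm x > R + 1 \<Longrightarrow> \<eta> x = 0"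
      using test_function_approx[OF \<psi> R \<open>e > 0\<close>] by blast
    have c: "continuous_on UNIV \<eta>" using test_functionD(1)[OF \<eta>(1), of 0] by simp
    have "(LINT x|lebesgue. g x * (\<psi> x - \<eta> x)) = (LINT x|lebesgue. g x * \<psi> x) - (LINT x|lebesgue. g x * \<eta> x)"
      using integrable_L1_loc_mult[OF g \<psi>] integrable_L1_loc_mult[OF g c \<eta>(3)]
      by (simp add: right_diff_distrib)
    moreover have "\<bar>LINT x|lebesgue. g x * (\<psi> x - \<eta> x)\<bar> \<le> e * I" unfolding I_def
      using \<psi>(2) \<eta>(3) by (intro integral_L1_loc_mult_bound[OF g]) (auto intro!: continuous_intros \<psi> c \<eta>(2))
    ultimately show ?thesis using 0[OF \<eta>(1)] by simp
  qed
  note * = this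
  have "\<bar>LINT x|lebesgue. g x * \<psi> x\<bar> \<le> 0 + e" if "e > 0" for e
  proof -
    have "\<bar>LINT x|lebesgue. g x * \<psi> x\<bar> \<le> (e / (I + 1)) * I" using I that by (intro *) auto
    also have "\<dots> \<le> e" using I that by (simp add: field_simps)
    finally show ?thesis by simp
  qed
  then have "\<bar>LINT x|lebesgue. g x * \<psi> x\<bar> \<le> 0" by (rule field_le_epsilon)
  then show ?thesis by simp
qed

text \<open>Continuous cutoffs built from the distance to \<open>K\<close> converge pointwise to the
  indicator of \<open>K\<close>; dominated convergence applies with the restriction of the absolute
  value of \<open>g\<close> to a ball.\<close>

lemma integral_test_zero_imp_compact_zero:
  fixes g :: "real^'n::finite \<Rightarrow> real"
  assumes g: "g \<in> L1_loc" and 0: "\<And>\<phi>. test_function \<phi> \<Longrightarrow> (LINT x|lebesgue. g x * \<phi> x) = 0"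
    and K: "compact K"
  shows "(LINT x:K|lebesgue. g x) = 0"
proof (cases "K = {}")
  case False
  obtain R where R: "R > 0" "\<And>x. x \<in> K \<Longrightarrow> norm x \<le> R"
    using compact_imp_bounded[OF K] by (auto simp: bounded_pos)
  \<comment> \<open>The second factor is 1 on \<open>K\<close> and keeps all supports in one ball,
    even for \<open>k = 0\<close>, where the first factor is identically 1.\<close>
  define \<psi> where "\<psi> k x = max 0 (1 - real k * infdist x K) * max 0 (min 1 (R + 1 - norm x))" for k x
  have cont: "continuous_on UNIV (\<psi> k)" for k unfolding \<psi>_def by (intro continuous_intros)
  have \<psi>0: "\<psi> k x = 0" if "norm x > R + 1" for k x using that by (simp add: \<psi>_def)
  have \<psi>1: "\<bar>\<psi> k x\<bar> \<le> 1" for k x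
    unfolding \<psi>_def using infdist_nonneg[of x K] by (auto simp: abs_mult intro!: mult_le_one)
  have lim: "(\<lambda>k. \<psi> k x) \<longlonglongrightarrow> indicator K x" for x
  proof (cases "x \<in> K")
    case True
    then show ?thesis using R(2)[of x] by (simp add: \<psi>_def)
  next
    case False
    then have "infdist x K > 0"
      using compact_imp_closed[OF K] \<open>K \<noteq> {}\<close> by (metis infdist_nonneg in_closed_iff_infdist_zero less_eq_real_def)
    then obtain k0 where k0: "real k0 * infdist x K > 1" using reals_Archimedean3 by blast
    have "\<forall>\<^sub>F k in sequentially. \<psi> k x = 0"
      using eventually_ge_at_top[of k0]
    proof eventually_elim
      case (elim k)
      then have "real k0 * infdist x K \<le> real k * infdist x K"
        using infdist_nonneg[of x K] by (intro mult_right_mono) auto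
      then show ?case using k0 by (simp add: \<psi>_def)
    qed
    then show ?thesis using False by (simp add: tendsto_eventually)
  qed
  have i1: "integrable lebesgue (\<lambda>x. indicator (cball 0 (R+1)) x *\<^sub>R \<bar>g x\<bar>)"
    using set_integrable_abs[OF L1_locD[OF g, of "cball 0 (R+1)"]] by (simp add: set_integrable_def)
  have "(\<lambda>k. LINT x|lebesgue. g x * \<psi> k x) \<longlonglongrightarrow> (LINT x|lebesgue. g x * indicator K x)"
  proof (rule integral_dominated_convergence[OF _ _ i1])
    show "(\<lambda>x. g x * indicator K x) \<in> borel_measurable lebesgue"
      using L1_loc_measurable[OF g] compact_imp_closed[OF K] by (intro borel_measurable_times borel_measurable_indicator) auto
    show "(\<lambda>x. g x * \<psi> k x) \<in> borel_measurable lebesgue" for k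
      using L1_loc_measurable[OF g] cont by (intro borel_measurable_times) auto
    show "AE x in lebesgue. (\<lambda>k. g x * \<psi> k x) \<longlonglongrightarrow> g x * indicator K x"
      by (intro AE_I2 tendsto_mult lim tendsto_const)
    show "AE x in lebesgue. norm (g x * \<psi> k x) \<le> indicator (cball 0 (R+1)) x *\<^sub>R \<bar>g x\<bar>" for k
      using \<psi>0[of _ k] mult_left_mono[OF \<psi>1[of k] abs_ge_zero[of "g _"]] by (intro AE_I2) (auto simp: indicator_def abs_mult)
  qed
  moreover have "(LINT x|lebesgue. g x * \<psi> k x) = 0" for k
    using R by (intro integral_test_zero_imp_continuous_zero[OF g 0 cont \<psi>0]) auto
  ultimately have "(LINT x|lebesgue. g x * indicator K x) = 0" by (simp add: LIMSEQ_const_iff)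
  then show ?thesis by (simp add: set_lebesgue_integral_def mult.commute)
qed (simp add: set_lebesgue_integral_def)

text \<open>Inner regularity: up to measure \<open>e\<close>, the part \<open>A n\<close> of the
  positivity set is a compact \<open>T\<close>. On \<open>T\<close> the function is positive with
  zero integral, so \<open>T\<close> is null and \<open>A n\<close> has measure below every
  \<open>e\<close>.\<close>

lemma integral_compact_zero_imp_nonpos_AE:
  fixes g :: "real^'n::finite \<Rightarrow> real"
  assumes g: "g \<in> L1_loc" and 0: "\<And>K. compact K \<Longrightarrow> (LINT x:K|lebesgue. g x) = 0"
  shows "AE x in lebesgue. g x \<le> 0"
proof -
  define A where "A n = {x. g x > 0} \<inter> cball 0 (real n)" for n
  have "{x. g x > 0} \<in> sets lebesgue"
    using L1_loc_measurable[OF g] by (simp add: borel_measurable_iff_greater)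
  then have A: "A n \<in> sets lebesgue" for n unfolding A_def by auto
  have "emeasure lebesgue (A n) \<le> 0 + ennreal e" if "e > 0" for n e
  proof -
    obtain T where T: "closed T" "T \<subseteq> A n" "A n - T \<in> lmeasurable" "emeasure lebesgue (A n - T) < ennreal e"
      using sets_lebesgue_inner_closed[OF A \<open>e > 0\<close>] by metis
    have cT: "compact T"
      using T(1,2) by (auto simp: compact_eq_bounded_closed A_def intro: bounded_subset[OF bounded_cball])
    have "AE x in lebesgue. indicator T x *\<^sub>R g x = 0"
    proof (subst integral_nonneg_eq_0_iff_AE[symmetric])
      show "integrable lebesgue (\<lambda>x. indicator T x *\<^sub>R g x)"
        using L1_locD[OF g cT] by (simp add: set_integrable_def)
      show "AE x in lebesgue. 0 \<le> indicator T x *\<^sub>R g x"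
        using T(2) by (intro AE_I2) (auto simp: indicator_def A_def less_imp_le)
      show "(LINT x|lebesgue. indicator T x *\<^sub>R g x) = 0" using 0[OF cT] by (simp add: set_lebesgue_integral_def)
    qed
    then have "AE x in lebesgue. x \<notin> T"
      by eventually_elim (use T(2) in \<open>auto simp: indicator_def A_def split: if_splits\<close>)
    then have T0: "T \<in> null_sets lebesgue"
      using T(1) by (subst (asm) AE_iff_null_sets[symmetric]) auto
    then have "emeasure lebesgue (A n) = emeasure lebesgue (A n - T)"
      by (rule emeasure_Diff_null_set[symmetric]) (rule A)
    with T(4) show ?thesis by simp
  qed
  then have "emeasure lebesgue (A n) = 0" for n
    by (metis ennreal_le_epsilon le_zero_eq)
  then have "A n \<in> null_sets lebesgue" for n using A by (simp add: null_sets_def)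
  then have "AE x in lebesgue. \<forall>n. x \<notin> A n" by (simp add: AE_all_countable AE_not_in)
  then show ?thesis
  proof eventually_elim
    case (elim x)
    obtain n where "norm x \<le> real n" using real_arch_simple by blast
    then show ?case using elim[rule_format, of n] by (auto simp: A_def)
  qed
qed

lemma du_Bois_Reymond:
  fixes g :: "real^'n::finite \<Rightarrow> real"
  assumes g: "g \<in> L1_loc" and 0: "\<And>\<phi>. test_function \<phi> \<Longrightarrow> (LINT x|lebesgue. g x * \<phi> x) = 0"
  shows "AE x in lebesgue. g x = 0"
proof -
  have K: "(LINT x:K|lebesgue. g x) = 0" if "compact K" for K
    using integral_test_zero_imp_compact_zero[OF g 0 that] .
  have "AE x in lebesgue. g x \<le> 0" by (rule integral_compact_zero_imp_nonpos_AE[OF g K])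
  moreover have "AE x in lebesgue. - g x \<le> 0"
    by (rule integral_compact_zero_imp_nonpos_AE)
       (use L1_loc_mult_continuous[OF g, of "\<lambda>_. -1"] K in \<open>auto simp: set_lebesgue_integral_def\<close>)
  ultimately show ?thesis by eventually_elim auto
qed

section \<open>Uniqueness and linearity of weak derivatives\<close>

lemma test_function_integrable:
  fixes g :: "real^'n::finite \<Rightarrow> real"
  assumes "g \<in> L1_loc" "test_function \<phi>"
  shows "integrable lebesgue (\<lambda>x. g x * \<phi> x)"
    and "integrable lebesgue (\<lambda>x. g x * partial_deriv i \<phi> x)"
proof -
  obtain R where R: "\<And>x. norm x > R \<Longrightarrow> \<phi> x = 0" using test_functionD(2)[OF assms(2)] by blast
  have "partial_deriv i \<phi> x = 0" if "norm x > R" for x by (rule partial_deriv_eq_0_outside[OF R that])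
  then show "integrable lebesgue (\<lambda>x. g x * partial_deriv i \<phi> x)"
    using test_functionD(1)[OF assms(2), of "Suc 0"] by (intro integrable_L1_loc_mult[OF assms(1)]) auto
  show "integrable lebesgue (\<lambda>x. g x * \<phi> x)"
    using test_functionD(1)[OF assms(2), of 0] R by (intro integrable_L1_loc_mult[OF assms(1)]) auto
qed

lemma has_weak_partial_unique:
  fixes u :: "real^'n::finite \<Rightarrow> real"
  assumes "has_weak_partial u i g" "has_weak_partial u i g'"
  shows "AE x in lebesgue. g x = g' x"
proof -
  have L: "g \<in> L1_loc" "g' \<in> L1_loc" using assms by (auto simp: has_weak_partial_def)
  have "AE x in lebesgue. g x + g' x * (-1) = 0"
  proof (rule du_Bois_Reymond)
    show "(\<lambda>x. g x + g' x * (-1)) \<in> L1_loc" by (intro L1_loc_add L1_loc_mult_continuous L continuous_intros)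
    fix \<phi> :: "real^'n \<Rightarrow> real" assume \<phi>: "test_function \<phi>"
    have "(LINT x|lebesgue. g x * \<phi> x) = (LINT x|lebesgue. g' x * \<phi> x)"
      using assms \<phi> by (simp add: has_weak_partial_def)
    then show "(LINT x|lebesgue. (g x + g' x * (-1)) * \<phi> x) = 0"
      using test_function_integrable(1)[OF L(1) \<phi>] test_function_integrable(1)[OF L(2) \<phi>]
      by (simp add: left_diff_distrib)
  qed
  then show ?thesis by simp
qed

lemma weak_partial_AE_eq:
  assumes "has_weak_partial u i g"
  shows "AE x in lebesgue. weak_partial i u x = g x"
  using has_weak_partial_unique[OF _ assms] someI[of "has_weak_partial u i", OF assms]
  by (simp add: weak_partial_def)

lemma has_weak_partial_linear:
  fixes u v :: "real^'n::finite \<Rightarrow> real"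
  assumes u: "has_weak_partial u i g" and v: "has_weak_partial v i h"
  shows "has_weak_partial (\<lambda>x. u x + c * v x) i (\<lambda>x. g x + c * h x)"
proof -
  have L: "u \<in> L1_loc" "g \<in> L1_loc" "v \<in> L1_loc" "h \<in> L1_loc"
    using u v by (auto simp: has_weak_partial_def)
  have c: "(\<lambda>x. c * f x) \<in> L1_loc" if "f \<in> L1_loc" for f :: "real^'n \<Rightarrow> real"
    using L1_loc_mult_continuous[OF that, of "\<lambda>_. c"] by (simp add: mult.commute)
  show ?thesis unfolding has_weak_partial_def
  proof (intro conjI allI impI L1_loc_add L c)
    fix \<phi> :: "real^'n \<Rightarrow> real" assume \<phi>: "test_function \<phi>"
    note [simp] = test_function_integrable[OF L(1) \<phi>] test_function_integrable[OF L(2) \<phi>]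
      test_function_integrable[OF L(3) \<phi>] test_function_integrable[OF L(4) \<phi>]
    show "(LINT x|lebesgue. (u x + c * v x) * partial_deriv i \<phi> x) = - (LINT x|lebesgue. (g x + c * h x) * \<phi> x)"
      using u v \<phi> by (simp add: has_weak_partial_def distrib_right mult.assoc)
  qed
qed

lemma has_weak_partial_const: "has_weak_partial (\<lambda>x. 0) i (\<lambda>x. 0)"
  by (simp add: has_weak_partial_def continuous_in_L1_loc)

section \<open>Increments against continuous test functions\<close>

lemma le_by_scaled_epsilon:
  fixes a b c :: real
  assumes "\<And>e. e > 0 \<Longrightarrow> a \<le> b + e * c"
  shows "a \<le> b"
proof (rule field_le_epsilon)
  fix e :: real assume e: "e > 0"
  have "a \<le> b + (e / (\<bar>c\<bar> + 1)) * c" using e by (intro assms) auto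
  also have "(e / (\<bar>c\<bar> + 1)) * c \<le> (e / (\<bar>c\<bar> + 1)) * (\<bar>c\<bar> + 1)" using e by (intro mult_left_mono) auto
  also have "\<dots> = e" by simp
  finally show "a \<le> b + e" by simp
qed

lemma lebesgue_integral_translate:
  fixes f :: "real^'n::finite \<Rightarrow> real"
  assumes "continuous_on UNIV f"
  shows "(LINT x|lebesgue. f (x + v)) = (LINT x|lebesgue. f x)"
proof -
  have f: "f \<in> borel_measurable borel" using assms by (rule borel_measurable_continuous_onI)
  have fv: "(\<lambda>x. f (x + v)) \<in> borel_measurable borel" using f by measurable
  have "(LINT x|lborel. f x) = (LINT x|distr lborel borel ((+) v). f x)"
    by (simp add: lborel_distr_plus)
  also have "\<dots> = (LINT x|lborel. f (v + x))" using f by (subst integral_distr) auto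
  finally show ?thesis using f fv by (simp add: integral_completion add.commute)
qed

text \<open>The set where \<open>f\<close> is nonzero is open and null, and a nonempty open set is
  never negligible.\<close>

lemma continuous_nonneg_integral_nonpos_imp_zero:
  fixes f :: "real^'n::finite \<Rightarrow> real"
  assumes f: "continuous_on UNIV f" and int: "integrable lebesgue f"
    and nn: "\<And>x. f x \<ge> 0" and 0: "(LINT x|lebesgue. f x) \<le> 0"
  shows "f x = 0"
proof (rule ccontr)
  assume x: "f x \<noteq> 0"
  have "(LINT x|lebesgue. f x) = 0" using 0 nn by (intro antisym integral_nonneg_AE) auto
  then have "AE x in lebesgue. f x = 0" using integral_nonneg_eq_0_iff_AE[OF int] nn by simp
  then have "AE x in lebesgue. x \<notin> {x. f x \<noteq> 0}" by simp
  moreover have o: "open {x. f x \<noteq> 0}" by (intro open_Collect_neq f continuous_intros)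
  ultimately have "negligible {x. f x \<noteq> 0}" by (simp add: negligible_iff_null_sets AE_iff_null_sets)
  then show False using open_not_negligible[OF o] x by blast
qed

lemma lebesgue_integral_eq_cbox_integral:
  fixes f :: "real^'n::finite \<Rightarrow> real"
  assumes f: "continuous_on UNIV f" and "\<And>x. x \<notin> cbox a b \<Longrightarrow> f x = 0"
  shows "(LINT x|lebesgue. f x) = integral (cbox a b) f"
proof -
  have "(LINT x|lebesgue. f x) = (LINT x:cbox a b|lebesgue. f x)"
    unfolding set_lebesgue_integral_def using assms(2)
    by (intro Bochner_Integration.integral_cong) (auto simp: indicator_def)
  also have "\<dots> = integral (cbox a b) f"
    by (rule set_lebesgue_integral_eq_integral) (rule L1_locD[OF continuous_in_L1_loc[OF f]], simp)
  finally show ?thesis .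
qed

text \<open>Leibniz rule on a box containing the support. The support conditions concern the
  products, so either the fixed factor or the shifted one may be the compactly supported factor;
  both situations occur below.\<close>

lemma DERIV_integral_shift:
  fixes u \<psi> \<psi>' :: "real^'n::finite \<Rightarrow> real"
  assumes u: "continuous_on UNIV u" and \<psi>: "continuous_on UNIV \<psi>" and \<psi>': "continuous_on UNIV \<psi>'"
    and deriv: "\<And>x t. ((\<lambda>t. \<psi> (x - t *\<^sub>R v)) has_real_derivative - \<psi>' (x - t *\<^sub>R v)) (at t)"
    and zero: "\<And>x t. norm x > R \<Longrightarrow> t \<in> {0..1} \<Longrightarrow> u x * \<psi> (x - t *\<^sub>R v) = 0"
      "\<And>x t. norm x > R \<Longrightarrow> t \<in> {0..1} \<Longrightarrow> u x * \<psi>' (x - t *\<^sub>R v) = 0"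
    and t: "t \<in> {0..1}"
  shows "((\<lambda>t. LINT x|lebesgue. u x * \<psi> (x - t *\<^sub>R v)) has_real_derivative
      - (LINT x|lebesgue. u x * \<psi>' (x - t *\<^sub>R v))) (at t within {0..1})"
proof -
  obtain a :: "real^'n" where a: "cball 0 R \<subseteq> cbox (-a) a"
    using bounded_subset_cbox_symmetric[OF bounded_cball] by metis
  have c: "continuous_on UNIV (\<lambda>x. u x * \<psi> (x - t *\<^sub>R v))" "continuous_on UNIV (\<lambda>x. u x * \<psi>' (x - t *\<^sub>R v))" for t
    by (intro continuous_intros u continuous_on_compose2[OF \<psi>] continuous_on_compose2[OF \<psi>'], auto)+
  have c2: "continuous_on S (\<lambda>(t, x). u x * \<psi>' (x - t *\<^sub>R v))" for S
    unfolding case_prod_unfold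
    by (intro continuous_intros continuous_on_compose2[OF u] continuous_on_compose2[OF \<psi>']) auto
  have n: "norm x > R" if "x \<notin> cbox (-a) a" for x using a that by force
  have "((\<lambda>t. integral (cbox (-a) a) (\<lambda>x. u x * \<psi> (x - t *\<^sub>R v))) has_real_derivative
      integral (cbox (-a) a) (\<lambda>x. - (u x * \<psi>' (x - t *\<^sub>R v)))) (at t within {0..1})"
  proof (rule leibniz_rule_field_derivative[OF _ _ _ t])
    show "((\<lambda>t. u x * \<psi> (x - t *\<^sub>R v)) has_real_derivative - (u x * \<psi>' (x - t *\<^sub>R v))) (at t within {0..1})" for t x
      using DERIV_cmult[OF has_field_derivative_at_within[OF deriv[of x t]], of "u x" "{0..1}"] by simp
    show "(\<lambda>x. u x * \<psi> (x - t *\<^sub>R v)) integrable_on cbox (-a) a" for t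
      by (rule integrable_continuous[OF continuous_on_subset[OF c(1)]]) simp
    show "continuous_on ({0..1} \<times> cbox (-a) a) (\<lambda>(t, x). - (u x * \<psi>' (x - t *\<^sub>R v)))"
      using continuous_on_minus[OF c2] by (simp add: case_prod_unfold)
  qed simp
  moreover have "integral (cbox (-a) a) (\<lambda>x. u x * \<psi> (x - t *\<^sub>R v)) = (LINT x|lebesgue. u x * \<psi> (x - t *\<^sub>R v))"
    if "t \<in> {0..1}" for t
    using n zero(1) that by (intro lebesgue_integral_eq_cbox_integral[symmetric] c) auto
  moreover have "integral (cbox (-a) a) (\<lambda>x. u x * \<psi>' (x - t *\<^sub>R v)) = (LINT x|lebesgue. u x * \<psi>' (x - t *\<^sub>R v))"
    using n zero(2) t by (intro lebesgue_integral_eq_cbox_integral[symmetric] c) auto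
  ultimately show ?thesis
    using t by (subst has_field_derivative_cong_eventually[of _ "\<lambda>t. integral (cbox (-a) a) (\<lambda>x. u x * \<psi> (x - t *\<^sub>R v))"])
      (auto simp: eventually_at_filter)
qed

lemma DERIV_along_axis:
  fixes f :: "real^'n::finite \<Rightarrow> real"
  assumes "f differentiable (at (x - t *\<^sub>R axis i 1))"
  shows "((\<lambda>t. f (x - t *\<^sub>R axis i 1)) has_real_derivative - partial_deriv i f (x - t *\<^sub>R axis i 1)) (at t)"
proof -
  let ?D = "frechet_derivative f (at (x - t *\<^sub>R axis i 1))"
  have D: "(f has_derivative ?D) (at (x - t *\<^sub>R axis i 1))" using assms by (rule differentiable_has_derivative)
  have "((\<lambda>t. x - t *\<^sub>R axis i 1) has_derivative (\<lambda>h. - (h *\<^sub>R axis i 1))) (at t)"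
    by (auto intro!: derivative_eq_intros)
  from has_derivative_compose[OF this D]
  have "((\<lambda>t. f (x - t *\<^sub>R axis i 1)) has_derivative (\<lambda>h. ?D (- (h *\<^sub>R axis i 1)))) (at t)" .
  moreover have "?D (- (h *\<^sub>R axis i 1)) = - partial_deriv i f (x - t *\<^sub>R axis i 1) * h" for h
    using has_derivative_bounded_linear[OF D] unfolding partial_deriv_def
    by (simp add: linear_simps bounded_linear.linear linear_neg linear_scale)
  ultimately show ?thesis
    unfolding has_field_derivative_def by (elim has_derivative_eq_rhs) (simp add: fun_eq_iff)
qed

text \<open>Only point values of \<open>u\<close> enter, and \<open>\<psi>\<close> may be merely
  continuous. Divided by \<open>t\<close>, this tends to the pairing of \<open>\<psi>\<close> with
  the weak derivative; see \<open>increment_quotient_weak\<close>.\<close>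

definition increment_pairing ::
    "(real^'n::finite \<Rightarrow> real) \<Rightarrow> 'n \<Rightarrow> real \<Rightarrow> (real^'n \<Rightarrow> real) \<Rightarrow> real" where
  "increment_pairing u i t \<psi> = (LINT x|lebesgue. (u (x + t *\<^sub>R axis i 1) - u x) * \<psi> x)"

context
  fixes u :: "real^'n::finite \<Rightarrow> real"
  assumes u: "continuous_on UNIV u"
begin

lemma continuous_increment: "continuous_on UNIV (\<lambda>x. u (x + v) - u x)"
  by (intro continuous_intros u continuous_on_compose2[OF u]) auto

lemma integrable_increment:
  assumes "continuous_on UNIV \<psi>" "\<And>x. norm x > R \<Longrightarrow> \<psi> x = 0"
  shows "integrable lebesgue (\<lambda>x. (u (x + v) - u x) * \<psi> x)"
  by (rule integrable_L1_loc_mult[OF continuous_in_L1_loc[OF continuous_increment] assms])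

lemma increment_pairing_diff:
  assumes "continuous_on UNIV \<psi>" "\<And>x. norm x > R \<Longrightarrow> \<psi> x = 0"
    and "continuous_on UNIV \<eta>" "\<And>x. norm x > R' \<Longrightarrow> \<eta> x = 0"
  shows "increment_pairing u i t (\<lambda>x. \<psi> x - \<eta> x) = increment_pairing u i t \<psi> - increment_pairing u i t \<eta>"
  using integrable_increment[OF assms(1,2)] integrable_increment[OF assms(3,4)]
  by (simp add: increment_pairing_def right_diff_distrib)

text \<open>Translation invariance moves the shift from \<open>u\<close> to \<open>\<psi>\<close>.
  The shift by 0 is kept so that the right side has the form F(t) - F(0), ready for difference
  quotients and the mean value inequality.\<close>

lemma increment_pairing_shift:
  assumes \<psi>: "continuous_on UNIV \<psi>"
    and int: "integrable lebesgue (\<lambda>x. u (x + t *\<^sub>R axis i 1) * \<psi> x)" "integrable lebesgue (\<lambda>x. u x * \<psi> x)"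
  shows "increment_pairing u i t \<psi> =
    (LINT x|lebesgue. u x * \<psi> (x - t *\<^sub>R axis i 1)) - (LINT x|lebesgue. u x * \<psi> (x - 0 *\<^sub>R axis i 1))"
proof -
  have "(LINT x|lebesgue. u (x + t *\<^sub>R axis i 1) * \<psi> x) = (LINT x|lebesgue. u x * \<psi> (x - t *\<^sub>R axis i 1))"
  proof -
    have "continuous_on UNIV (\<lambda>x. u x * \<psi> (x - t *\<^sub>R axis i 1))"
      by (intro continuous_intros u continuous_on_compose2[OF \<psi>]) auto
    from lebesgue_integral_translate[OF this, of "t *\<^sub>R axis i 1"] show ?thesis by simp
  qed
  then show ?thesis using int by (simp add: increment_pairing_def left_diff_distrib)
qed

lemma DERIV_integral_shift_test:
  assumes \<psi>: "test_function \<psi>" and t: "t \<in> {0..1}"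
  shows "((\<lambda>t. LINT x|lebesgue. u x * \<psi> (x - t *\<^sub>R axis i 1)) has_real_derivative
      - (LINT x|lebesgue. u x * partial_deriv i \<psi> (x - t *\<^sub>R axis i 1))) (at t within {0..1})"
proof -
  obtain R where R: "\<And>x. norm x > R \<Longrightarrow> \<psi> x = 0" using test_functionD(2)[OF \<psi>] by blast
  have C1: "Ck (Suc 0) \<psi>" by (rule test_functionD(1)[OF \<psi>])
  have R': "partial_deriv i \<psi> x = 0" if "norm x > R" for x by (rule partial_deriv_eq_0_outside[OF R that])
  have n: "norm (x - t *\<^sub>R axis i (1::real)) > R" if "norm x > R + 1" "t \<in> {0..1}" for x t
    using that norm_triangle_ineq2[of x "t *\<^sub>R axis i (1::real)"] by (auto simp: norm_axis_1)
  show ?thesis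
    using C1 n R R'
    by (intro DERIV_integral_shift[where R="R + 1"] u t DERIV_along_axis) (auto intro: Ck_imp_continuous[OF C1])
qed

text \<open>This computes the distributional derivative of any continuous \<open>u\<close>. Weak
  derivatives are identified later by finding a second expression for the same limit.\<close>

lemma increment_quotient_test:
  assumes \<psi>: "test_function \<psi>"
  shows "((\<lambda>t. increment_pairing u i t \<psi> / t) \<longlongrightarrow> - (LINT x|lebesgue. u x * partial_deriv i \<psi> x)) (at_right 0)"
proof -
  have c: "continuous_on UNIV \<psi>" using test_functionD(1)[OF \<psi>, of 0] by simp
  obtain R where R: "\<And>x. norm x > R \<Longrightarrow> \<psi> x = 0" using test_functionD(2)[OF \<psi>] by blast
  have "increment_pairing u i t \<psi> =
    (LINT x|lebesgue. u x * \<psi> (x - t *\<^sub>R axis i 1)) - (LINT x|lebesgue. u x * \<psi> (x - 0 *\<^sub>R axis i 1))" for t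
    by (intro increment_pairing_shift c integrable_L1_loc_mult[OF _ c R] continuous_in_L1_loc u
        continuous_on_compose2[OF u] continuous_intros) auto
  with DERIV_integral_shift_test[OF \<psi>, of 0 i] show ?thesis
    by (simp add: has_field_derivative_iff at_within_Icc_at_right)
qed

text \<open>A shifted test function is a test function, so the shifted integral has as derivative
  the pairing of \<open>g\<close> with the shifted \<open>\<psi>\<close>. This is bounded uniformly
  in the shift, and the mean value inequality applies. Shifts of length at most 1 enlarge the
  support radius to \<open>R + 1\<close>.\<close>

lemma increment_pairing_bound_test:
  assumes g: "has_weak_partial u i g" and \<psi>: "test_function \<psi>"
    and R: "\<And>x. norm x > R \<Longrightarrow> \<psi> x = 0" and S: "\<And>x. \<bar>\<psi> x\<bar> \<le> S" and t: "t \<in> {0..1}"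
  shows "\<bar>increment_pairing u i t \<psi>\<bar> \<le> t * (S * (LINT x:cball 0 (R + 1)|lebesgue. \<bar>g x\<bar>))"
proof -
  have C: "Ck k \<psi>" for k by (rule test_functionD(1)[OF \<psi>])
  have c: "continuous_on UNIV \<psi>" using C[of 0] by simp
  let ?F = "\<lambda>t. LINT x|lebesgue. u x * \<psi> (x - t *\<^sub>R axis i 1)"
  have gL: "g \<in> L1_loc" using g by (simp add: has_weak_partial_def)
  have n: "norm (x - t *\<^sub>R axis i (1::real)) > R" if "norm x > R + 1" "t \<in> {0..1}" for x :: "real^'n" and t
    using that norm_triangle_ineq2[of x "t *\<^sub>R axis i (1::real)"] by (auto simp: norm_axis_1)
  have D: "(?F has_real_derivative (LINT x|lebesgue. g x * \<psi> (x - t *\<^sub>R axis i 1))) (at t within {0..1})"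
    if t: "t \<in> {0..1}" for t
  proof -
    have "test_function (\<lambda>x. \<psi> (x - t *\<^sub>R axis i 1))"
      by (rule test_functionI[where R = "R + 1"]) (use C Ck_translate n R t in auto)
    moreover have eq: "partial_deriv i (\<lambda>x. \<psi> (x - t *\<^sub>R axis i 1)) = (\<lambda>x. partial_deriv i \<psi> (x - t *\<^sub>R axis i 1))"
      using C[of "Suc 0"] by (intro ext partial_deriv_translate) simp
    ultimately show ?thesis
      using DERIV_integral_shift_test[OF \<psi> t, of i] g by (auto simp: has_weak_partial_def dest!: spec)
  qed
  have "\<bar>?F t - ?F 0\<bar> \<le> (S * (LINT x:cball 0 (R + 1)|lebesgue. \<bar>g x\<bar>)) * \<bar>t - 0\<bar>"
  proof (rule field_differentiable_bound[of "{0..1}" ?F, simplified real_norm_def])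
    show "\<bar>LINT x|lebesgue. g x * \<psi> (x - s *\<^sub>R axis i 1)\<bar> \<le> S * (LINT x:cball 0 (R + 1)|lebesgue. \<bar>g x\<bar>)"
      if "s \<in> {0..1}" for s
      by (rule integral_L1_loc_mult_bound[OF gL])
         (use R n that S in \<open>auto intro!: continuous_intros continuous_on_compose2[OF c]\<close>)
  qed (use D t in auto)
  moreover have "increment_pairing u i t \<psi> = ?F t - ?F 0"
    by (intro increment_pairing_shift c integrable_L1_loc_mult[OF _ c R] continuous_in_L1_loc u
        continuous_on_compose2[OF u] continuous_intros) auto
  ultimately show ?thesis using t by (simp add: mult.commute)
qed

text \<open>The bound for test functions involves only the supremum and the support, so it survives
  uniform approximation. The error term \<open>e * J\<close> carries no factor \<open>t\<close>,
  which is harmless because \<open>t\<close> is fixed while \<open>e\<close> tends to 0.\<close>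

lemma increment_pairing_bound:
  assumes g: "has_weak_partial u i g" and \<psi>: "continuous_on UNIV \<psi>"
    and R: "R \<ge> 0" "\<And>x. norm x > R \<Longrightarrow> \<psi> x = 0" and S: "\<And>x. \<bar>\<psi> x\<bar> \<le> S" and t: "t \<in> {0..1}"
  shows "\<bar>increment_pairing u i t \<psi>\<bar> \<le> t * (S * (LINT x:cball 0 (R + 2)|lebesgue. \<bar>g x\<bar>))"
proof -
  define I where "I = (LINT x:cball 0 (R + 2)|lebesgue. \<bar>g x\<bar>)"
  define J where "J = (LINT x:cball 0 (R + 1)|lebesgue. \<bar>u (x + t *\<^sub>R axis i 1) - u x\<bar>)"
  show ?thesis
  proof (rule le_by_scaled_epsilon)
    fix e :: real assume e: "e > 0"
    obtain \<eta> where \<eta>: "test_function \<eta>" "\<And>x. \<bar>\<psi> x - \<eta> x\<bar> \<le> e" "\<And>x. norm x > R + 1 \<Longrightarrow> \<eta> x = 0"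
      using test_function_approx[OF \<psi> R(2) R(1) e] by blast
    have c: "continuous_on UNIV \<eta>" using test_functionD(1)[OF \<eta>(1), of 0] by simp
    have "\<bar>\<eta> x\<bar> \<le> S + e" for x using S[of x] \<eta>(2)[of x] by linarith
    then have 1: "\<bar>increment_pairing u i t \<eta>\<bar> \<le> t * ((S + e) * I)"
      using increment_pairing_bound_test[OF g \<eta>(1), of "R + 1" "S + e", OF \<eta>(3) _ t] by (simp add: I_def add.assoc)
    have 2: "\<bar>increment_pairing u i t (\<lambda>x. \<psi> x - \<eta> x)\<bar> \<le> e * J"
      unfolding increment_pairing_def J_def
      by (rule integral_L1_loc_mult_bound[OF continuous_in_L1_loc[OF continuous_increment]])
         (use \<psi> c R \<eta> in \<open>auto intro!: continuous_intros\<close>)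
    have "increment_pairing u i t (\<lambda>x. \<psi> x - \<eta> x) = increment_pairing u i t \<psi> - increment_pairing u i t \<eta>"
      by (rule increment_pairing_diff[OF \<psi> R(2) c \<eta>(3)])
    with 1 2 have "\<bar>increment_pairing u i t \<psi>\<bar> \<le> t * ((S + e) * I) + e * J" by linarith
    then show "\<bar>increment_pairing u i t \<psi>\<bar> \<le> t * (S * (LINT x:cball 0 (R + 2)|lebesgue. \<bar>g x\<bar>)) + e * (t * I + J)"
      by (simp add: I_def[symmetric] algebra_simps)
  qed
qed

text \<open>Replacing \<open>\<psi>\<close> by a nearby test function changes the quotient by at
  most \<open>e * I\<close> for all \<open>t\<close> in (0,1), by
  \<open>increment_pairing_bound\<close>. This uniformity in \<open>t\<close> permits the passage to
  the limit.\<close>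

lemma increment_quotient_weak:
  assumes g: "has_weak_partial u i g" and \<psi>: "continuous_on UNIV \<psi>"
    and R: "R \<ge> 0" "\<And>x. norm x > R \<Longrightarrow> \<psi> x = 0"
  shows "((\<lambda>t. increment_pairing u i t \<psi> / t) \<longlongrightarrow> (LINT x|lebesgue. g x * \<psi> x)) (at_right 0)"
proof (rule tendstoI)
  fix \<epsilon> :: real assume \<epsilon>: "\<epsilon> > 0"
  have gL: "g \<in> L1_loc" using g by (simp add: has_weak_partial_def)
  \<comment> \<open>The approximation error is supported in radius \<open>R + 1\<close>, and
    \<open>increment_pairing_bound\<close> adds 2 to the radius.\<close>
  define I where "I = (LINT x:cball 0 (R + 3)|lebesgue. \<bar>g x\<bar>)"
  define J where "J = (LINT x:cball 0 (R + 1)|lebesgue. \<bar>g x\<bar>)"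
  have IJ: "I \<ge> 0" "J \<ge> 0"
    unfolding I_def J_def set_lebesgue_integral_def by (auto intro!: integral_nonneg_AE)
  \<comment> \<open>The three errors are \<open>e * I\<close>, \<open>e\<close> and
    \<open>e * J\<close>; the remaining \<open>e\<close> makes the final inequality strict.\<close>
  define e where "e = \<epsilon> / (I + J + 2)"
  have e: "e > 0" "e * (I + J + 2) = \<epsilon>" using IJ \<epsilon> by (auto simp: e_def)
  obtain \<eta> where \<eta>: "test_function \<eta>" "\<And>x. \<bar>\<psi> x - \<eta> x\<bar> \<le> e" "\<And>x. norm x > R + 1 \<Longrightarrow> \<eta> x = 0"
    using test_function_approx[OF \<psi> R(2) R(1) e(1)] by blast
  have c: "continuous_on UNIV \<eta>" using test_functionD(1)[OF \<eta>(1), of 0] by simp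
  have d: "continuous_on UNIV (\<lambda>x. \<psi> x - \<eta> x)" "\<And>x. norm x > R + 1 \<Longrightarrow> \<psi> x - \<eta> x = 0"
    using \<psi> c R \<eta>(3) by (auto intro: continuous_intros)
  have "(LINT x|lebesgue. g x * (\<psi> x - \<eta> x)) = (LINT x|lebesgue. g x * \<psi> x) - (LINT x|lebesgue. g x * \<eta> x)"
    using integrable_L1_loc_mult[OF gL \<psi> R(2)] integrable_L1_loc_mult[OF gL c \<eta>(3)] by (simp add: right_diff_distrib)
  moreover have "\<bar>LINT x|lebesgue. g x * (\<psi> x - \<eta> x)\<bar> \<le> e * J" unfolding J_def
    by (rule integral_L1_loc_mult_bound[OF gL d \<eta>(2)])
  ultimately have 1: "\<bar>(LINT x|lebesgue. g x * \<psi> x) - (LINT x|lebesgue. g x * \<eta> x)\<bar> \<le> e * J" by simp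
  have "((\<lambda>t. increment_pairing u i t \<eta> / t) \<longlongrightarrow> (LINT x|lebesgue. g x * \<eta> x)) (at_right 0)"
    using increment_quotient_test[OF \<eta>(1), of i] g \<eta>(1) by (simp add: has_weak_partial_def)
  from tendstoD[OF this e(1)] have "\<forall>\<^sub>F t in at_right 0. \<bar>increment_pairing u i t \<eta> / t - (LINT x|lebesgue. g x * \<eta> x)\<bar> < e"
    by (simp add: dist_real_def)
  moreover have "\<forall>\<^sub>F t in at_right (0::real). t \<in> {0<..<1}" by (rule eventually_at_right_real) simp
  ultimately show "\<forall>\<^sub>F t in at_right 0. dist (increment_pairing u i t \<psi> / t) (LINT x|lebesgue. g x * \<psi> x) < \<epsilon>"
  proof eventually_elim
    case (elim t)
    have "\<bar>increment_pairing u i t \<psi> - increment_pairing u i t \<eta>\<bar> \<le> t * (e * I)"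
      using increment_pairing_bound[OF g d(1) _ d(2) \<eta>(2), of "R + 1" t] elim(2) R(1)
      by (simp add: increment_pairing_diff[OF \<psi> R(2) c \<eta>(3)] I_def add.assoc)
    then have "\<bar>increment_pairing u i t \<psi> / t - increment_pairing u i t \<eta> / t\<bar> \<le> e * I"
      using elim(2) by (simp add: diff_divide_distrib[symmetric] field_simps)
    then have "\<bar>increment_pairing u i t \<psi> / t - (LINT x|lebesgue. g x * \<psi> x)\<bar> < e * I + e + e * J"
      using elim(1) 1 by linarith
    also have "\<dots> < \<epsilon>" using e by (simp add: algebra_simps)
    finally show ?case by (simp add: dist_real_def)
  qed
qed

text \<open>For zero derivative \<open>increment_pairing_bound\<close> says that every increment
  with \<open>t\<close> at most 1 pairs to 0. Pairing the increment with itself times a cutoff makes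
  it vanish; longer shifts are divided into \<open>n\<close> equal short ones.\<close>

lemma zero_weak_partial_imp_constant_along_axis:
  assumes g: "has_weak_partial u i (\<lambda>x. 0)"
  shows "u (x + s *\<^sub>R axis i 1) = u x"
proof -
  have step: "u (x + t *\<^sub>R axis i 1) = u x" if t: "t \<in> {0..1}" for x t
  proof (rule ccontr)
    let ?d = "\<lambda>x. u (x + t *\<^sub>R axis i 1) - u x"
    assume "u (x + t *\<^sub>R axis i 1) \<noteq> u x"
    define \<psi> where "\<psi> y = ?d y * max 0 (1 - dist x y)" for y
    have c: "continuous_on UNIV \<psi>" unfolding \<psi>_def by (intro continuous_intros continuous_increment)
    have z: "\<psi> y = 0" if "norm y > norm x + 1" for y
      using that norm_triangle_ineq2[of y x] by (simp add: \<psi>_def dist_norm norm_minus_commute)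
    obtain S where S: "\<And>y. \<bar>\<psi> y\<bar> \<le> S" using bounded_of_continuous_compact_support[OF c z] by blast
    from increment_pairing_bound[OF g c _ z S t, of "norm x + 1"]
    have 0: "(LINT y|lebesgue. ?d y * \<psi> y) = 0" by (simp add: increment_pairing_def)
    have nn: "?d y * \<psi> y \<ge> 0" for y by (simp add: \<psi>_def mult.assoc[symmetric])
    have "?d x * \<psi> x = 0"
    proof (rule continuous_nonneg_integral_nonpos_imp_zero[where f = "\<lambda>y. ?d y * \<psi> y"])
      show "integrable lebesgue (\<lambda>y. ?d y * \<psi> y)" by (rule integrable_increment[OF c z])
    qed (use nn 0 in \<open>auto intro: continuous_intros continuous_increment c\<close>)
    with \<open>u (x + t *\<^sub>R axis i 1) \<noteq> u x\<close> show False by (simp add: \<psi>_def)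
  qed
  have nat: "u (x + (real n * t) *\<^sub>R axis i 1) = u x" if "t \<in> {0..1}" for x t n
  proof (induction n)
    case (Suc n)
    then show ?case using step[OF that, of "x + (real n * t) *\<^sub>R axis i 1"] by (simp add: algebra_simps)
  qed simp
  have pos: "u (x + s *\<^sub>R axis i 1) = u x" if "s \<ge> 0" for x s
  proof -
    obtain n where n: "s < real n" using reals_Archimedean2 by blast
    then show ?thesis using nat[of "s / real n" x n] that by (simp add: divide_le_eq_1)
  qed
  show ?thesis
    using pos[of s x] pos[of "-s" "x + s *\<^sub>R axis i 1"] by (cases "s \<ge> 0") auto
qed

text \<open>Travel from \<open>y\<close> to \<open>x\<close> by changing one coordinate at a
  time.\<close>

lemma zero_weak_gradient_imp_constant:
  assumes "\<And>i. has_weak_partial u i (\<lambda>x. 0)"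
  shows "u x = u y"
proof -
  have "u (y + (\<Sum>i\<in>A. ((x - y) $ i) *\<^sub>R axis i 1)) = u y" if "finite A" for A
    using that
  proof induction
    case (insert i A)
    then show ?case
      using zero_weak_partial_imp_constant_along_axis[OF assms, of "y + (\<Sum>i\<in>A. ((x - y) $ i) *\<^sub>R axis i 1)" "(x - y) $ i" i]
      by (simp add: algebra_simps)
  qed simp
  from this[of UNIV] have "u (y + (x - y)) = u y"
    using basis_expansion[of "x - y"] by (simp add: scalar_mult_eq_scaleR)
  then show ?thesis by simp
qed

end

section \<open>Chain rule and integration by parts\<close>

lemma uniform_small_increment:
  fixes k \<phi> :: "real^'n::finite \<Rightarrow> real"
  assumes k: "continuous_on UNIV k" and \<phi>: "continuous_on UNIV \<phi>" "\<And>x. norm x > R \<Longrightarrow> \<phi> x = 0"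
    and e: "e > 0"
  shows "\<forall>\<^sub>F t in at_right 0. \<forall>x. \<bar>(k (x + t *\<^sub>R axis i 1) - k x) * \<phi> x\<bar> \<le> e"
proof -
  obtain S where S: "S > 0" "\<And>x. \<bar>\<phi> x\<bar> \<le> S" using bounded_of_continuous_compact_support[OF \<phi>] by blast
  have "uniformly_continuous_on (cball 0 (R + 1)) k"
    by (intro compact_uniformly_continuous continuous_on_subset[OF k]) auto
  then obtain d where d: "d > 0" "\<And>x y. x \<in> cball 0 (R + 1) \<Longrightarrow> y \<in> cball 0 (R + 1) \<Longrightarrow> dist y x < d \<Longrightarrow> dist (k y) (k x) < e / S"
    unfolding uniformly_continuous_on_def using e S(1) by (metis divide_pos_pos)
  have "\<forall>\<^sub>F t in at_right (0::real). t \<in> {0<..<min 1 d}" by (rule eventually_at_right_real) (use d in auto)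
  then show ?thesis
  proof (eventually_elim, intro allI)
    fix t x assume t: "t \<in> {0<..<min 1 d}"
    show "\<bar>(k (x + t *\<^sub>R axis i 1) - k x) * \<phi> x\<bar> \<le> e"
    proof (cases "norm x \<le> R")
      case True
      have "norm (x + t *\<^sub>R axis i (1::real)) \<le> R + 1"
        using norm_triangle_ineq[of x "t *\<^sub>R axis i 1"] True t by simp
      then have "dist (k (x + t *\<^sub>R axis i 1)) (k x) < e / S"
        using True t by (intro d(2)) (simp_all del: mem_cball add: mem_cball_0, simp add: dist_norm)
      then have "\<bar>(k (x + t *\<^sub>R axis i 1) - k x)\<bar> * \<bar>\<phi> x\<bar> \<le> (e / S) * S"
        using S e by (intro mult_mono) (auto simp: dist_real_def)
      then show ?thesis using S by (simp add: abs_mult)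
    qed (use \<phi>(2)[of x] e in auto)
  qed
qed

text \<open>The subgradient inequality, used at \<open>f x\<close> and at the shifted value and
  multiplied by the nonnegative \<open>\<phi>\<close>, yields
  \<open>L t \<le> M t \<le> U t\<close>. The quotient of \<open>L\<close> converges by
  \<open>increment_quotient_weak\<close>, and that of \<open>U\<close> has the same limit.\<close>

lemma increment_quotient_convex:
  fixes f \<phi> :: "real^'n::finite \<Rightarrow> real" and G s :: "real \<Rightarrow> real"
  assumes f: "continuous_on UNIV f" and g: "has_weak_partial f i g"
    and G: "continuous_on UNIV G" and s: "continuous_on UNIV s" "\<And>a b. G a + s a * (b - a) \<le> G b"
    and \<phi>: "continuous_on UNIV \<phi>" "\<And>x. norm x > R \<Longrightarrow> \<phi> x = 0" "\<And>x. \<phi> x \<ge> 0" and R: "R \<ge> 0"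
  shows "((\<lambda>t. increment_pairing (\<lambda>x. G (f x)) i t \<phi> / t) \<longlongrightarrow> (LINT x|lebesgue. g x * (s (f x) * \<phi> x))) (at_right 0)"
proof -
  let ?k = "\<lambda>x. s (f x)"
  have k: "continuous_on UNIV ?k" by (rule continuous_on_compose2[OF s(1) f]) auto
  have Gf: "continuous_on UNIV (\<lambda>x. G (f x))" by (rule continuous_on_compose2[OF G f]) auto
  have kt: "continuous_on UNIV (\<lambda>x. ?k (x + v))" for v
    by (rule continuous_on_compose2[OF k]) (auto intro: continuous_intros)
  define L where "L t = increment_pairing f i t (\<lambda>x. ?k x * \<phi> x)" for t
  define U where "U t = increment_pairing f i t (\<lambda>x. ?k (x + t *\<^sub>R axis i 1) * \<phi> x)" for t
  define M where "M t = increment_pairing (\<lambda>x. G (f x)) i t \<phi>" for t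
  have cL: "continuous_on UNIV (\<lambda>x. ?k x * \<phi> x)" "continuous_on UNIV (\<lambda>x. ?k (x + v) * \<phi> x)" for v
    by (intro continuous_intros k kt \<phi>)+
  have z: "?k x * \<phi> x = 0" "?k (x + v) * \<phi> x = 0" if "norm x > R" for x v using \<phi>(2)[OF that] by auto
  have LM: "L t \<le> M t" and MU: "M t \<le> U t" for t
    unfolding L_def M_def U_def increment_pairing_def
  proof (safe intro!: integral_mono integrable_increment[OF f cL(1) z(1)] integrable_increment[OF f cL(2) z(2)]
      integrable_increment[OF Gf \<phi>(1,2)])
    fix x
    let ?b = "f (x + t *\<^sub>R axis i 1)"
    have "?k x * (?b - f x) \<le> G ?b - G (f x)" using s(2)[of "f x" ?b] by simp
    from mult_right_mono[OF this \<phi>(3)[of x]]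
    show "(?b - f x) * (?k x * \<phi> x) \<le> (G ?b - G (f x)) * \<phi> x" by (simp add: algebra_simps)
    have "G ?b - G (f x) \<le> s ?b * (?b - f x)" using s(2)[of "?b" "f x"] by (simp add: algebra_simps)
    from mult_right_mono[OF this \<phi>(3)[of x]]
    show "(G ?b - G (f x)) * \<phi> x \<le> (?b - f x) * (s ?b * \<phi> x)" by (simp add: algebra_simps)
  qed
  have limL: "((\<lambda>t. L t / t) \<longlongrightarrow> (LINT x|lebesgue. g x * (?k x * \<phi> x))) (at_right 0)"
    unfolding L_def by (rule increment_quotient_weak[OF f g cL(1) R z(1)])
  have "((\<lambda>t. U t / t - L t / t) \<longlongrightarrow> 0) (at_right 0)"
  proof (rule tendstoI)
    fix \<epsilon> :: real assume \<epsilon>: "\<epsilon> > 0"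
    define I where "I = (LINT x:cball 0 (R + 2)|lebesgue. \<bar>g x\<bar>)"
    have I: "I \<ge> 0" unfolding I_def set_lebesgue_integral_def by (auto intro!: integral_nonneg_AE)
    define e where "e = \<epsilon> / (I + 1)"
    have e: "e > 0" "e * I < \<epsilon>" using I \<epsilon> by (auto simp: e_def field_simps)
    have "\<forall>\<^sub>F t in at_right (0::real). t \<in> {0<..<1}" by (rule eventually_at_right_real) simp
    moreover have "\<forall>\<^sub>F t in at_right 0. \<forall>x. \<bar>(?k (x + t *\<^sub>R axis i 1) - ?k x) * \<phi> x\<bar> \<le> e"
      by (rule uniform_small_increment[OF k \<phi>(1) _ e(1)]) (rule \<phi>(2))
    ultimately show "\<forall>\<^sub>F t in at_right 0. dist (U t / t - L t / t) 0 < \<epsilon>"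
    proof eventually_elim
      case (elim t)
      let ?d = "\<lambda>x. ?k (x + t *\<^sub>R axis i 1) * \<phi> x - ?k x * \<phi> x"
      \<comment> \<open>Both are pairings of the same increment of \<open>f\<close>; the two weights
        differ by at most \<open>e\<close> because \<open>s\<close> composed with \<open>f\<close>
        is uniformly continuous near the support of \<open>\<phi>\<close>.\<close>
      have "U t - L t = increment_pairing f i t ?d"
        unfolding U_def L_def by (rule increment_pairing_diff[OF f cL(2) z(2) cL(1) z(1), symmetric])
      also have "\<bar>\<dots>\<bar> \<le> t * (e * I)"
        unfolding I_def using elim \<phi>(2) R
        by (intro increment_pairing_bound[OF f g]) (auto simp: left_diff_distrib intro!: continuous_on_diff cL)
      finally have "\<bar>U t / t - L t / t\<bar> \<le> e * I"
        using elim(1) by (simp add: diff_divide_distrib[symmetric] field_simps)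
      then show ?case using e(2) by (simp add: dist_real_def del: abs_divide)
    qed
  qed
  from tendsto_add[OF this limL] have limU: "((\<lambda>t. U t / t) \<longlongrightarrow> (LINT x|lebesgue. g x * (?k x * \<phi> x))) (at_right 0)"
    by simp
  have "((\<lambda>t. M t / t) \<longlongrightarrow> (LINT x|lebesgue. g x * (?k x * \<phi> x))) (at_right 0)"
    by (rule tendsto_sandwich[OF _ _ limL limU]; rule eventually_mono[OF eventually_at_right_less])
       (auto intro!: divide_right_mono LM MU)
  then show ?thesis by (simp add: M_def)
qed

text \<open>The increments of \<open>G \<circ> f\<close> lie between \<open>s (f x)\<close> and \<open>s (f (x + t e\<^sub>i))\<close>
  times those of \<open>f\<close>, so no mollification of \<open>f\<close> is needed.\<close>

lemma has_weak_partial_convex_compose: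
  fixes f :: "real^'n::finite \<Rightarrow> real" and G s :: "real \<Rightarrow> real"
  assumes f: "continuous_on UNIV f" and g: "has_weak_partial f i g"
    and G: "continuous_on UNIV G" and s: "continuous_on UNIV s" "\<And>a b. G a + s a * (b - a) \<le> G b"
  shows "has_weak_partial (\<lambda>x. G (f x)) i (\<lambda>x. g x * s (f x))"
proof -
  have gL: "g \<in> L1_loc" using g by (simp add: has_weak_partial_def)
  have k: "continuous_on UNIV (\<lambda>x. s (f x))" by (rule continuous_on_compose2[OF s(1) f]) auto
  have Gf: "continuous_on UNIV (\<lambda>x. G (f x))" by (rule continuous_on_compose2[OF G f]) auto
  show ?thesis unfolding has_weak_partial_def
  proof (intro conjI allI impI continuous_in_L1_loc[OF Gf] L1_loc_mult_continuous[OF gL k])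
    fix \<phi> :: "real^'n \<Rightarrow> real" assume \<phi>: "test_function \<phi>"
    have c: "continuous_on UNIV \<phi>" using test_functionD(1)[OF \<phi>, of 0] by simp
    obtain R where R: "R > 0" "\<And>x. norm x > R \<Longrightarrow> \<phi> x = 0" using test_functionD(2)[OF \<phi>] by blast
    \<comment> \<open>The squeeze requires a nonnegative weight. The positive and negative parts of
      \<open>\<phi>\<close> are only continuous, which the limit theorems for increments
      allow.\<close>
    define P where "P x = max (\<phi> x) 0" for x
    define Q where "Q x = max (- \<phi> x) 0" for x
    have PQ: "continuous_on UNIV P" "continuous_on UNIV Q" "\<And>x. norm x > R \<Longrightarrow> P x = 0" "\<And>x. norm x > R \<Longrightarrow> Q x = 0"
        "\<And>x. P x \<ge> 0" "\<And>x. Q x \<ge> 0"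
      using R(2) by (auto simp: P_def Q_def intro!: continuous_intros c)
    have eq: "P x - Q x = \<phi> x" for x by (auto simp: P_def Q_def)
    have "((\<lambda>t. increment_pairing (\<lambda>x. G (f x)) i t P / t - increment_pairing (\<lambda>x. G (f x)) i t Q / t) \<longlongrightarrow>
        (LINT x|lebesgue. g x * (s (f x) * P x)) - (LINT x|lebesgue. g x * (s (f x) * Q x))) (at_right 0)"
      using R(1) by (intro tendsto_diff increment_quotient_convex[OF f g G s PQ(1,3,5)]
          increment_quotient_convex[OF f g G s PQ(2,4,6)]) auto
    moreover have "increment_pairing (\<lambda>x. G (f x)) i t P / t - increment_pairing (\<lambda>x. G (f x)) i t Q / t
        = increment_pairing (\<lambda>x. G (f x)) i t \<phi> / t" for t
      using increment_pairing_diff[OF Gf PQ(1,3,2,4), where i = i and t = t] by (simp add: eq diff_divide_distrib)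
    moreover have "(LINT x|lebesgue. g x * (s (f x) * P x)) - (LINT x|lebesgue. g x * (s (f x) * Q x))
        = (LINT x|lebesgue. g x * s (f x) * \<phi> x)"
    proof -
      have "integrable lebesgue (\<lambda>x. g x * (s (f x) * P x))" "integrable lebesgue (\<lambda>x. g x * (s (f x) * Q x))"
        using PQ by (auto intro!: integrable_L1_loc_mult[OF gL, of _ R] continuous_intros k)
      then show ?thesis
        by (subst Bochner_Integration.integral_diff[symmetric])
           (simp_all add: eq[symmetric] algebra_simps)
    qed
    ultimately have "((\<lambda>t. increment_pairing (\<lambda>x. G (f x)) i t \<phi> / t) \<longlongrightarrow> (LINT x|lebesgue. g x * s (f x) * \<phi> x)) (at_right 0)"
      by simp
    from tendsto_unique[OF _ increment_quotient_test[OF Gf \<phi>] this]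
    show "(LINT x|lebesgue. G (f x) * partial_deriv i \<phi> x) = - (LINT x|lebesgue. g x * s (f x) * \<phi> x)"
      by (simp add: trivial_limit_at_right_real)
  qed
qed

text \<open>The limit of the increment quotient is computed twice: with the shift on
  \<open>\<phi>\<close> by \<open>increment_quotient_test\<close>, and with the shift on
  \<open>h\<close> by differentiating under the integral. In the latter, \<open>\<phi>\<close> is
  the fixed factor and the direction is reversed.\<close>

lemma has_weak_partial_C1:
  fixes h :: "real^'n::finite \<Rightarrow> real"
  assumes h: "\<And>x. h differentiable (at x)" and h': "continuous_on UNIV (partial_deriv i h)"
  shows "has_weak_partial h i (partial_deriv i h)"
  unfolding has_weak_partial_def
proof (intro conjI allI impI continuous_in_L1_loc h')
  show c: "continuous_on UNIV h"
    using h by (simp add: continuous_on_eq_continuous_at differentiable_imp_continuous_within)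
  fix \<phi> :: "real^'n \<Rightarrow> real" assume \<phi>: "test_function \<phi>"
  have \<phi>c: "continuous_on UNIV \<phi>" using test_functionD(1)[OF \<phi>, of 0] by simp
  obtain R where R: "R > 0" "\<And>x. norm x > R \<Longrightarrow> \<phi> x = 0" using test_functionD(2)[OF \<phi>] by blast
  let ?e = "axis i (1::real) :: real^'n"
  have D: "((\<lambda>t. h (x - t *\<^sub>R (- ?e))) has_real_derivative - (- partial_deriv i h (x - t *\<^sub>R (- ?e)))) (at t)" for x t
    using DERIV_along_axis[OF h, where x = x and t = "- t" and i = i] DERIV_mirror[of "\<lambda>t. h (x - t *\<^sub>R ?e)" _ "t"] by simp
  have "((\<lambda>t. LINT x|lebesgue. \<phi> x * h (x - t *\<^sub>R (- ?e))) has_real_derivative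
      - (LINT x|lebesgue. \<phi> x * (- partial_deriv i h (x - 0 *\<^sub>R (- ?e))))) (at 0 within {0..1})"
    using R(2) D by (intro DERIV_integral_shift[where R = R] \<phi>c c continuous_intros h') auto
  then have "((\<lambda>t. ((LINT x|lebesgue. \<phi> x * h (x + t *\<^sub>R ?e)) - (LINT x|lebesgue. \<phi> x * h x)) / t) \<longlongrightarrow>
      (LINT x|lebesgue. \<phi> x * partial_deriv i h x)) (at_right 0)"
    by (simp add: has_field_derivative_iff at_within_Icc_at_right)
  moreover have "(LINT x|lebesgue. \<phi> x * h (x + t *\<^sub>R ?e)) - (LINT x|lebesgue. \<phi> x * h x) = increment_pairing h i t \<phi>" for t
  proof -
    have "integrable lebesgue (\<lambda>x. h (x + t *\<^sub>R ?e) * \<phi> x)" "integrable lebesgue (\<lambda>x. h x * \<phi> x)"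
      by (intro integrable_L1_loc_mult[OF _ \<phi>c R(2)] continuous_in_L1_loc c continuous_on_compose2[OF c] continuous_intros; simp)+
    then show ?thesis by (simp add: increment_pairing_def left_diff_distrib right_diff_distrib mult.commute)
  qed
  ultimately have "((\<lambda>t. increment_pairing h i t \<phi> / t) \<longlongrightarrow> (LINT x|lebesgue. \<phi> x * partial_deriv i h x)) (at_right 0)"
    by simp
  from tendsto_unique[OF _ increment_quotient_test[OF c \<phi>] this]
  show "(LINT x|lebesgue. h x * partial_deriv i \<phi> x) = - (LINT x|lebesgue. partial_deriv i h x * \<phi> x)"
    by (simp add: trivial_limit_at_right_real mult.commute)
qed

text \<open>Here the compact support lies on \<open>w\<close> and \<open>g\<close>, while
  \<open>\<psi>\<close> may be nonzero everywhere. A cutoff makes \<open>\<psi>\<close> admissible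
  for the increment limits without changing any of the integrals.\<close>

lemma weak_integration_by_parts:
  fixes w \<psi> :: "real^'n::finite \<Rightarrow> real"
  assumes w: "continuous_on UNIV w" and g: "has_weak_partial w i g" and R: "R \<ge> 0"
    and z: "\<And>x. norm x > R \<Longrightarrow> w x = 0" "\<And>x. norm x > R \<Longrightarrow> g x = 0"
    and \<psi>: "\<And>x. \<psi> differentiable (at x)" and \<psi>': "continuous_on UNIV (partial_deriv i \<psi>)"
  shows "(LINT x|lebesgue. w x * partial_deriv i \<psi> x) = - (LINT x|lebesgue. g x * \<psi> x)"
proof -
  let ?e = "axis i (1::real) :: real^'n"
  \<comment> \<open>The cutoff is 1 up to radius \<open>R + 1\<close>, so it remains 1 on the ball
    of radius \<open>R\<close> after a shift of length at most 1.\<close>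
  define \<zeta> where "\<zeta> x = max 0 (min 1 (R + 2 - norm x))" for x :: "real^'n"
  have c: "continuous_on UNIV \<psi>"
    using \<psi> by (simp add: continuous_on_eq_continuous_at differentiable_imp_continuous_within)
  have cz: "continuous_on UNIV (\<lambda>x. \<psi> x * \<zeta> x)" unfolding \<zeta>_def by (intro continuous_intros c)
  have zz: "\<psi> x * \<zeta> x = 0" if "norm x > R + 2" for x using that by (simp add: \<zeta>_def)
  have one: "\<zeta> (x - t *\<^sub>R ?e) = 1" if "norm x \<le> R" "t \<in> {0..1}" for x t
    using that norm_triangle_ineq4[of x "t *\<^sub>R ?e"] by (simp add: \<zeta>_def)
  have "((\<lambda>t. increment_pairing w i t (\<lambda>x. \<psi> x * \<zeta> x) / t) \<longlongrightarrow> (LINT x|lebesgue. g x * (\<psi> x * \<zeta> x))) (at_right 0)"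
    using R by (intro increment_quotient_weak[OF w g cz _ zz]) auto
  moreover have "(LINT x|lebesgue. g x * (\<psi> x * \<zeta> x)) = (LINT x|lebesgue. g x * \<psi> x)"
  proof (intro Bochner_Integration.integral_cong refl)
    fix x show "g x * (\<psi> x * \<zeta> x) = g x * \<psi> x"
      using one[of x 0] z(2)[of x] by (cases "norm x \<le> R") auto
  qed
  ultimately have 1: "((\<lambda>t. increment_pairing w i t (\<lambda>x. \<psi> x * \<zeta> x) / t) \<longlongrightarrow> (LINT x|lebesgue. g x * \<psi> x)) (at_right 0)"
    by simp
  let ?F = "\<lambda>t. LINT x|lebesgue. w x * \<psi> (x - t *\<^sub>R ?e)"
  have eq: "(LINT x|lebesgue. w x * (\<psi> (x - t *\<^sub>R ?e) * \<zeta> (x - t *\<^sub>R ?e))) = ?F t" if "t \<in> {0..1}" for t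
  proof (intro Bochner_Integration.integral_cong refl)
    fix x show "w x * (\<psi> (x - t *\<^sub>R ?e) * \<zeta> (x - t *\<^sub>R ?e)) = w x * \<psi> (x - t *\<^sub>R ?e)"
      using one[of x t] that z(1)[of x] by (cases "norm x \<le> R") auto
  qed
  have inc: "increment_pairing w i t (\<lambda>x. \<psi> x * \<zeta> x) = ?F t - ?F 0" if "t \<in> {0..1}" for t
  proof -
    have "integrable lebesgue (\<lambda>x. w (x + t *\<^sub>R ?e) * (\<psi> x * \<zeta> x))" "integrable lebesgue (\<lambda>x. w x * (\<psi> x * \<zeta> x))"
      by (intro integrable_L1_loc_mult[OF _ cz zz] continuous_in_L1_loc w continuous_on_compose2[OF w] continuous_intros; simp)+
    from increment_pairing_shift[OF w cz this] show ?thesis using eq[OF that] eq[of 0] by simp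
  qed
  have "(?F has_real_derivative - (LINT x|lebesgue. w x * partial_deriv i \<psi> (x - 0 *\<^sub>R ?e))) (at 0 within {0..1})"
    using z(1) by (intro DERIV_integral_shift[where R = R] w c \<psi>' DERIV_along_axis \<psi>) auto
  then have "((\<lambda>t. (?F t - ?F 0) / t) \<longlongrightarrow> - (LINT x|lebesgue. w x * partial_deriv i \<psi> x)) (at_right 0)"
    by (simp add: has_field_derivative_iff at_within_Icc_at_right)
  moreover have "\<forall>\<^sub>F t in at_right (0::real). t \<in> {0<..<1}" by (rule eventually_at_right_real) simp
  then have "\<forall>\<^sub>F t in at_right 0. (?F t - ?F 0) / t = increment_pairing w i t (\<lambda>x. \<psi> x * \<zeta> x) / t"
    by eventually_elim (subst inc, auto)
  ultimately have "((\<lambda>t. increment_pairing w i t (\<lambda>x. \<psi> x * \<zeta> x) / t) \<longlongrightarrow> - (LINT x|lebesgue. w x * partial_deriv i \<psi> x)) (at_right 0)"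
    by (rule Lim_transform_eventually)
  from tendsto_unique[OF _ 1 this] show ?thesis by (simp add: trivial_limit_at_right_real)
qed

section \<open>The convexity estimate and the weak maximum principle\<close>

definition clamp01 :: "real \<Rightarrow> real" where
  "clamp01 t = max 0 (min 1 t)"

text \<open>The value is 0 for t <= 0, t^2/2 on [0,1] and t - 1/2 beyond. This form exhibits it as
  the maximum over s in [0,1] of s t - s^2/2, attained at \<open>clamp01 t\<close>; convexity and
  the subgradient are then immediate.\<close>

definition huber :: "real \<Rightarrow> real" where
  "huber t = clamp01 t * t - (clamp01 t)\<^sup>2 / 2"

lemma clamp01_bounds: "0 \<le> clamp01 t" "clamp01 t \<le> 1"
  by (auto simp: clamp01_def)

lemma clamp01_eq_0_iff: "clamp01 t = 0 \<longleftrightarrow> t \<le> 0"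
  by (auto simp: clamp01_def)

lemma continuous_on_clamp01: "continuous_on UNIV clamp01"
  unfolding clamp01_def[abs_def] by (intro continuous_intros)

lemma continuous_on_huber: "continuous_on UNIV huber"
  unfolding huber_def[abs_def] by (intro continuous_intros continuous_on_clamp01) auto

lemma huber_ge: "0 \<le> s \<Longrightarrow> s \<le> 1 \<Longrightarrow> s * t - s\<^sup>2 / 2 \<le> huber t"
proof -
  assume s: "0 \<le> s" "s \<le> 1"
  consider "t \<le> 0" | "0 \<le> t" "t \<le> 1" | "t \<ge> 1" by linarith
  then show ?thesis
  proof cases
    case 1
    then show ?thesis using s by (simp add: huber_def clamp01_def mult_nonneg_nonpos order_trans[of _ 0])
  next
    case 2
    then show ?thesis using sum_squares_bound[of s t] by (simp add: huber_def clamp01_def power2_eq_square)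
  next
    case 3
    have "0 \<le> (1 - s) * (t - 1) + (1 - s)\<^sup>2 / 2" using 3 s by simp
    then have "s * t - s\<^sup>2 / 2 \<le> t - 1 / 2" by (simp add: power2_eq_square field_simps)
    then show ?thesis using 3 by (simp add: huber_def clamp01_def)
  qed
qed

lemma huber_subgradient: "huber a + clamp01 a * (b - a) \<le> huber b"
  using huber_ge[OF clamp01_bounds, of a b] by (simp add: huber_def algebra_simps)

lemma huber_nonpos: "t \<le> 0 \<Longrightarrow> huber t = 0"
  by (simp add: huber_def clamp01_def)

lemma huber_nonneg: "huber t \<ge> 0"
  using huber_ge[of 0 t] by simp

lemma huber_pos: "t > 0 \<Longrightarrow> huber t > 0"
proof -
  assume t: "t > 0"
  then have "clamp01 t > 0" "clamp01 t \<le> t" by (auto simp: clamp01_def)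
  then have "clamp01 t * clamp01 t \<le> clamp01 t * t" "clamp01 t * clamp01 t > 0" by auto
  then show ?thesis by (simp add: huber_def power2_eq_square)
qed

lemma powr_above_tangent:
  fixes A B p :: real
  assumes p: "p \<ge> 1" and A: "A \<ge> 0" and B: "B > 0"
  shows "B powr p + p * B powr (p - 1) * (A - B) \<le> A powr p"
proof (cases "A = 0")
  case True
  have "B powr (p - 1) * B = B powr p" using B by (simp add: powr_mult_base mult.commute)
  then have "B powr p + p * B powr (p - 1) * (A - B) = (1 - p) * B powr p"
    using True by (simp add: algebra_simps)
  also have "\<dots> \<le> 0" using p by (simp add: mult_nonpos_nonneg)
  finally show ?thesis using True p by simp
next
  case False
  have "A powr p - B powr p \<ge> (p * B powr (p - 1)) * (A - B)"
    using A B False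
    by (intro convex_on_imp_above_tangent[OF powr_convex[OF p]])
       (auto simp: interior_open intro!: derivative_eq_intros)
  then show ?thesis by simp
qed

text \<open>Cauchy-Schwarz reduces the claim to the scalar tangent inequality at
  \<open>norm b\<close>.\<close>

lemma norm_powr_above_tangent:
  fixes a b :: "'a::real_inner"
  assumes p: "p \<ge> 1" and b: "b \<noteq> 0"
  shows "norm b powr p + p * norm b powr (p - 2) * (b \<bullet> (a - b)) \<le> norm a powr p"
proof -
  have eq: "norm b powr (p - 2) * norm b = norm b powr (p - 1)"
    using b by (simp add: powr_mult_base mult.commute)
  have "b \<bullet> (a - b) \<le> norm b * (norm a - norm b)"
    using norm_cauchy_schwarz[of b a] by (simp add: inner_diff_right power2_norm_eq_inner[symmetric] power2_eq_square algebra_simps)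
  then have "p * norm b powr (p - 2) * (b \<bullet> (a - b)) \<le> p * norm b powr (p - 2) * (norm b * (norm a - norm b))"
    using p by (intro mult_left_mono) auto
  also have "\<dots> = p * norm b powr (p - 1) * (norm a - norm b)"
    by (simp add: eq[symmetric])
  finally show ?thesis using powr_above_tangent[OF p norm_ge_zero[of a], of "norm b"] b by simp
qed

text \<open>Average the tangent inequalities at the convex combination itself; the linear terms
  cancel.\<close>

lemma norm_powr_convex:
  fixes a b :: "'a::real_inner"
  assumes p: "p \<ge> 1" and \<theta>: "0 \<le> \<theta>" "\<theta> \<le> 1"
  shows "norm ((1 - \<theta>) *\<^sub>R a + \<theta> *\<^sub>R b) powr p \<le> (1 - \<theta>) * norm a powr p + \<theta> * norm b powr p"
proof (cases "(1 - \<theta>) *\<^sub>R a + \<theta> *\<^sub>R b = 0")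
  case False
  define c where "c = (1 - \<theta>) *\<^sub>R a + \<theta> *\<^sub>R b"
  let ?k = "p * norm c powr (p - 2)"
  have "c \<bullet> ((1 - \<theta>) *\<^sub>R (a - c) + \<theta> *\<^sub>R (b - c)) = 0" by (simp add: c_def algebra_simps)
  then have "(1 - \<theta>) * (c \<bullet> (a - c)) + \<theta> * (c \<bullet> (b - c)) = 0" by (simp add: inner_add_right)
  then have 0: "?k * ((1 - \<theta>) * (c \<bullet> (a - c)) + \<theta> * (c \<bullet> (b - c))) = 0" by simp
  have "norm c powr p = (1 - \<theta>) * (norm c powr p + ?k * (c \<bullet> (a - c))) + \<theta> * (norm c powr p + ?k * (c \<bullet> (b - c)))"
    using 0 by (simp add: algebra_simps)
  also have "\<dots> \<le> (1 - \<theta>) * norm a powr p + \<theta> * norm b powr p"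
    using \<theta> False by (intro add_mono mult_left_mono norm_powr_above_tangent p) (auto simp: c_def)
  finally show ?thesis by (simp add: c_def)
qed (use \<theta> p in auto)

section \<open>Gradients, energy and the comparison estimate\<close>

lemma has_weak_partial_measurable: "has_weak_partial u i g \<Longrightarrow> g \<in> borel_measurable lebesgue"
  by (simp add: has_weak_partial_def L1_loc_measurable)

lemma borel_measurable_norm_powr:
  fixes F :: "real^'n::finite \<Rightarrow> real^'n"
  assumes "\<And>i. (\<lambda>x. F x $ i) \<in> borel_measurable lebesgue"
  shows "(\<lambda>x. norm (F x) powr p) \<in> borel_measurable lebesgue"
proof -
  have "(\<lambda>x. sqrt (\<Sum>i\<in>UNIV. (F x $ i)\<^sup>2) powr p) \<in> borel_measurable lebesgue"
    using assms by measurable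
  then show ?thesis by (simp add: norm_vec_def L2_set_def)
qed

text \<open>This frees the energy from the choice made in \<open>weak_partial\<close>: versions
  agree almost everywhere, and there are finitely many components.\<close>

lemma energy_eq:
  fixes F :: "real^'n::finite \<Rightarrow> real^'n"
  assumes F: "\<And>i. has_weak_partial v i (\<lambda>x. F x $ i)"
  shows "energy p v = (LINT x|lebesgue. norm (F x) powr p)"
  unfolding energy_def
proof (rule integral_cong_AE)
  have W: "has_weak_partial v i (weak_partial i v)" for i
    unfolding weak_partial_def using F by (metis someI)
  show "(\<lambda>x. norm (weak_gradient v x) powr p) \<in> borel_measurable lebesgue"
    using has_weak_partial_measurable[OF W] by (intro borel_measurable_norm_powr) (simp add: weak_gradient_def)
  show "(\<lambda>x. norm (F x) powr p) \<in> borel_measurable lebesgue"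
    by (intro borel_measurable_norm_powr has_weak_partial_measurable[OF F])
  have "AE x in lebesgue. \<forall>i\<in>UNIV. weak_partial i v x = F x $ i"
    using weak_partial_AE_eq[OF F] by (intro AE_finite_allI) auto
  then show "AE x in lebesgue. norm (weak_gradient v x) powr p = norm (F x) powr p"
  proof eventually_elim
    case (elim x)
    then have "weak_gradient v x = F x" by (simp add: weak_gradient_def vec_eq_iff)
    then show ?case by simp
  qed
qed

text \<open>Via the largest component; it converts componentwise p-integrability into integrability
  of the p-th power of the gradient norm.\<close>

lemma norm_powr_le_sum:
  fixes y :: "real^'n::finite"
  assumes "p \<ge> 0"
  shows "norm y powr p \<le> real CARD('n) powr p * (\<Sum>i\<in>UNIV. \<bar>y $ i\<bar> powr p)"
proof -
  obtain k where k: "\<And>i. \<bar>y $ i\<bar> \<le> \<bar>y $ k\<bar>"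
    using Max_in[of "range (\<lambda>i. \<bar>y $ i\<bar>)"] Max_ge[of "range (\<lambda>i. \<bar>y $ i\<bar>)"] by fastforce
  have "norm y \<le> (\<Sum>i\<in>UNIV. \<bar>y $ i\<bar>)" by (rule norm_le_l1_cart)
  also have "\<dots> \<le> real CARD('n) * \<bar>y $ k\<bar>" using sum_bounded_above[of UNIV "\<lambda>i. \<bar>y $ i\<bar>"] k by simp
  finally have "norm y powr p \<le> (real CARD('n) * \<bar>y $ k\<bar>) powr p" using assms by (intro powr_mono2) auto
  also have "\<dots> = real CARD('n) powr p * \<bar>y $ k\<bar> powr p" by (simp add: powr_mult)
  also have "\<dots> \<le> real CARD('n) powr p * (\<Sum>i\<in>UNIV. \<bar>y $ i\<bar> powr p)"
    by (intro mult_left_mono member_le_sum) auto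
  finally show ?thesis .
qed

lemma D1p_gradient:
  fixes u :: "real^'n::finite \<Rightarrow> real"
  assumes u: "u \<in> D1p p" and p: "p \<ge> 0"
  obtains F :: "real^'n \<Rightarrow> real^'n" where "\<And>i. has_weak_partial u i (\<lambda>x. F x $ i)"
    "integrable lebesgue (\<lambda>x. norm (F x) powr p)"
proof -
  from u have "\<forall>i. \<exists>g. g \<in> Lp p \<and> has_weak_partial u i g" by (auto simp: D1p_def)
  then obtain g where g: "\<And>i. g i \<in> Lp p" "\<And>i. has_weak_partial u i (g i)" by metis
  define F where "F x = (\<chi> i. g i x)" for x
  have W: "has_weak_partial u i (\<lambda>x. F x $ i)" for i using g(2) by (simp add: F_def)
  have "integrable lebesgue (\<lambda>x. norm (F x) powr p)"
  proof (rule Bochner_Integration.integrable_bound)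
    show "integrable lebesgue (\<lambda>x. real CARD('n) powr p * (\<Sum>i\<in>UNIV. \<bar>g i x\<bar> powr p))"
      using g(1) by (intro integrable_mult_right Bochner_Integration.integrable_sum) (auto simp: Lp_def)
    show "(\<lambda>x. norm (F x) powr p) \<in> borel_measurable lebesgue"
      by (intro borel_measurable_norm_powr has_weak_partial_measurable[OF W])
    show "AE x in lebesgue. norm (norm (F x) powr p) \<le> norm (real CARD('n) powr p * (\<Sum>i\<in>UNIV. \<bar>g i x\<bar> powr p))"
    proof (intro AE_I2)
      fix x
      show "norm (norm (F x) powr p) \<le> norm (real CARD('n) powr p * (\<Sum>i\<in>UNIV. \<bar>g i x\<bar> powr p))"
        using norm_powr_le_sum[OF p, of "F x"] by (simp add: F_def abs_mult sum_nonneg)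
    qed
  qed
  with W show thesis by (rule that)
qed

lemma D1pI:
  fixes F :: "real^'n::finite \<Rightarrow> real^'n"
  assumes W: "\<And>i. has_weak_partial u i (\<lambda>x. F x $ i)"
    and int: "integrable lebesgue (\<lambda>x. norm (F x) powr p)" and p: "p \<ge> 0"
  shows "u \<in> D1p p"
  unfolding D1p_def
proof (intro CollectI conjI allI)
  show "u \<in> L1_loc" using W by (simp add: has_weak_partial_def)
  fix i
  have m: "(\<lambda>x. F x $ i) \<in> borel_measurable lebesgue" by (rule has_weak_partial_measurable[OF W])
  have "integrable lebesgue (\<lambda>x. \<bar>F x $ i\<bar> powr p)"
    by (rule Bochner_Integration.integrable_bound[OF int])
       (use m p in \<open>auto intro!: AE_I2 powr_mono2 component_le_norm_cart\<close>)
  with m have "(\<lambda>x. F x $ i) \<in> Lp p" by (simp add: Lp_def)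
  with W show "\<exists>g\<in>Lp p. has_weak_partial u i g" by blast
qed

text \<open>The competitor \<open>v\<close> equals \<open>u\<close> wherever
  \<open>u \<le> h\<close>, hence at the data points. Its gradient \<open>V\<close> is pointwise a
  convex combination of \<open>F\<close> and \<open>H\<close>, so its energy is at most that of
  \<open>u\<close>, minus the weighted integral for \<open>F\<close>, plus the one for
  \<open>H\<close>. Minimality and cancellation of the energy of \<open>u\<close> leave the
  inequality.\<close>

lemma minimizer_comparison:
  fixes u h :: "real^'n::finite \<Rightarrow> real" and F H :: "real^'n \<Rightarrow> real^'n"
  assumes min: "is_minimizer p N x a u" and p: "p \<ge> 1"
    and F: "\<And>i. has_weak_partial u i (\<lambda>y. F y $ i)" "integrable lebesgue (\<lambda>y. norm (F y) powr p)"
    and h: "continuous_on UNIV h" "\<And>i. has_weak_partial h i (\<lambda>y. H y $ i)"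
    and le: "\<And>j. j \<in> {1..N} \<Longrightarrow> u (x j) \<le> h (x j)"
    and int: "integrable lebesgue (\<lambda>y. clamp01 (u y - h y) * norm (H y) powr p)"
  shows "\<And>i. has_weak_partial (\<lambda>y. huber (u y - h y)) i (\<lambda>y. (F y $ i - H y $ i) * clamp01 (u y - h y))"
    and "integrable lebesgue (\<lambda>y. clamp01 (u y - h y) * norm (F y) powr p)"
    and "(LINT y|lebesgue. clamp01 (u y - h y) * norm (F y) powr p) \<le>
      (LINT y|lebesgue. clamp01 (u y - h y) * norm (H y) powr p)"
proof -
  define \<theta> where "\<theta> y = clamp01 (u y - h y)" for y
  define v where "v y = u y + (-1) * huber (u y - h y)" for y
  define V where "V y = (1 - \<theta> y) *\<^sub>R F y + \<theta> y *\<^sub>R H y" for y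
  have u: "continuous_on UNIV u" "u \<in> D1p p" "\<And>j. j \<in> {1..N} \<Longrightarrow> u (x j) = a j"
    and opt: "\<And>v. v \<in> admissible p N x a \<Longrightarrow> energy p u \<le> energy p v"
    using min by (auto simp: is_minimizer_def admissible_def D1p_cont_def)
  have f: "continuous_on UNIV (\<lambda>y. u y - h y)" by (intro continuous_intros u h)
  have \<theta>: "0 \<le> \<theta> y" "\<theta> y \<le> 1" for y by (auto simp: \<theta>_def clamp01_bounds)
  have \<theta>c: "continuous_on UNIV \<theta>"
    unfolding \<theta>_def by (rule continuous_on_compose2[OF continuous_on_clamp01 f]) auto
  have "has_weak_partial (\<lambda>y. u y - h y) i (\<lambda>y. F y $ i - H y $ i)" for i
    using has_weak_partial_linear[OF F(1) h(2), where i = i and c = "-1"] by simp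
  from has_weak_partial_convex_compose[OF f this continuous_on_huber continuous_on_clamp01 huber_subgradient]
  show W: "has_weak_partial (\<lambda>y. huber (u y - h y)) i (\<lambda>y. (F y $ i - H y $ i) * clamp01 (u y - h y))" for i .
  have V: "has_weak_partial v i (\<lambda>y. V y $ i)" for i
    using has_weak_partial_linear[OF F(1) W, where i = i and c = "-1"]
    by (simp add: v_def[abs_def] V_def \<theta>_def algebra_simps)
  show int1: "integrable lebesgue (\<lambda>y. clamp01 (u y - h y) * norm (F y) powr p)"
  proof (rule Bochner_Integration.integrable_bound[OF F(2)])
    show "(\<lambda>y. clamp01 (u y - h y) * norm (F y) powr p) \<in> borel_measurable lebesgue"
      using \<theta>c F(2) by (intro borel_measurable_times) (auto simp: \<theta>_def[abs_def])
    show "AE y in lebesgue. norm (clamp01 (u y - h y) * norm (F y) powr p) \<le> norm (norm (F y) powr p)"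
      using \<theta> by (intro AE_I2) (auto simp: \<theta>_def abs_mult mult_left_le_one_le)
  qed
  have eq: "(\<lambda>y. (1 - \<theta> y) * norm (F y) powr p + \<theta> y * norm (H y) powr p) =
      (\<lambda>y. norm (F y) powr p - clamp01 (u y - h y) * norm (F y) powr p + clamp01 (u y - h y) * norm (H y) powr p)"
    by (simp add: \<theta>_def fun_eq_iff algebra_simps)
  have int2: "integrable lebesgue (\<lambda>y. (1 - \<theta> y) * norm (F y) powr p + \<theta> y * norm (H y) powr p)"
    unfolding eq using F(2) int int1 by auto
  have Vle: "norm (V y) powr p \<le> (1 - \<theta> y) * norm (F y) powr p + \<theta> y * norm (H y) powr p" for y
    unfolding V_def by (rule norm_powr_convex[OF p \<theta>])
  have intV: "integrable lebesgue (\<lambda>y. norm (V y) powr p)"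
  proof (rule Bochner_Integration.integrable_bound[OF int2])
    show "(\<lambda>y. norm (V y) powr p) \<in> borel_measurable lebesgue"
      by (intro borel_measurable_norm_powr has_weak_partial_measurable[OF V])
    show "AE y in lebesgue. norm (norm (V y) powr p) \<le> norm ((1 - \<theta> y) * norm (F y) powr p + \<theta> y * norm (H y) powr p)"
      using Vle by (intro AE_I2) (auto intro: order_trans[OF _ abs_ge_self])
  qed
  have "continuous_on UNIV v"
    unfolding v_def by (intro continuous_intros u continuous_on_compose2[OF continuous_on_huber f]) auto
  moreover have "v \<in> D1p p" using D1pI[OF V intV] p by simp
  moreover have "v (x j) = a j" if "j \<in> {1..N}" for j
    using u(3)[OF that] le[OF that] by (simp add: v_def huber_nonpos)
  ultimately have "v \<in> admissible p N x a" by (simp add: admissible_def D1p_cont_def)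
  then have "energy p u \<le> energy p v" by (rule opt)
  then have "(LINT y|lebesgue. norm (F y) powr p) \<le> (LINT y|lebesgue. norm (V y) powr p)"
    by (simp add: energy_eq[OF F(1)] energy_eq[OF V])
  also have "\<dots> \<le> (LINT y|lebesgue. (1 - \<theta> y) * norm (F y) powr p + \<theta> y * norm (H y) powr p)"
    by (intro integral_mono intV int2 Vle)
  also have "\<dots> = (LINT y|lebesgue. norm (F y) powr p) - (LINT y|lebesgue. clamp01 (u y - h y) * norm (F y) powr p)
      + (LINT y|lebesgue. clamp01 (u y - h y) * norm (H y) powr p)"
    unfolding eq using F(2) int int1 by simp
  finally show "(LINT y|lebesgue. clamp01 (u y - h y) * norm (F y) powr p) \<le>
      (LINT y|lebesgue. clamp01 (u y - h y) * norm (H y) powr p)" by simp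
qed

text \<open>For constant \<open>h\<close> the right side of the comparison is 0, so almost
  everywhere the weight or \<open>F\<close> vanishes. Their product is the gradient of
  \<open>huber (u - M)\<close>.\<close>

lemma minimizer_le_Max:
  fixes u :: "real^'n::finite \<Rightarrow> real"
  assumes min: "is_minimizer p N x a u" and p: "p \<ge> 1" and N: "N \<ge> 1"
    and M: "\<And>j. j \<in> {1..N} \<Longrightarrow> a j \<le> M"
  shows "u y \<le> M"
proof -
  have u: "continuous_on UNIV u" "u \<in> D1p p" "\<And>j. j \<in> {1..N} \<Longrightarrow> u (x j) = a j"
    using min by (auto simp: is_minimizer_def admissible_def D1p_cont_def)
  obtain F :: "real^'n \<Rightarrow> real^'n" where F: "\<And>i. has_weak_partial u i (\<lambda>x. F x $ i)"
    "integrable lebesgue (\<lambda>x. norm (F x) powr p)"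
    by (rule D1p_gradient[OF u(2)]) (use p in auto)
  have pd: "partial_deriv i (\<lambda>y. M) = (\<lambda>y. 0)" for i :: 'n by (intro ext partial_deriv_eq) auto
  have hM: "has_weak_partial (\<lambda>y::real^'n. M) i (\<lambda>y. (0::real^'n) $ i)" for i
    using has_weak_partial_C1[of "\<lambda>y. M" i] by (simp add: pd)
  let ?\<theta> = "\<lambda>y. clamp01 (u y - M)"
  have le: "u (x j) \<le> M" if "j \<in> {1..N}" for j using u(3) M that by simp
  have 0: "(LINT y|lebesgue. ?\<theta> y * norm (F y) powr p) \<le> 0"
    using minimizer_comparison(3)[OF min p F continuous_on_const hM le] by simp
  have int: "integrable lebesgue (\<lambda>y. ?\<theta> y * norm (F y) powr p)"
    using minimizer_comparison(2)[OF min p F continuous_on_const hM le] by simp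
  have W: "has_weak_partial (\<lambda>y. huber (u y - M)) i (\<lambda>y. F y $ i * ?\<theta> y)" for i
    using minimizer_comparison(1)[OF min p F continuous_on_const hM le] by simp
  have nn: "0 \<le> ?\<theta> y * norm (F y) powr p" for y by (simp add: clamp01_bounds)
  have "(LINT y|lebesgue. ?\<theta> y * norm (F y) powr p) = 0"
    using 0 integral_nonneg_AE[of "\<lambda>y. ?\<theta> y * norm (F y) powr p" lebesgue] nn by (auto intro: antisym)
  then have AE: "AE y in lebesgue. ?\<theta> y * norm (F y) powr p = 0"
    using integral_nonneg_eq_0_iff_AE[OF int] nn by simp
  have "has_weak_partial (\<lambda>y. huber (u y - M)) i (\<lambda>y. 0)" for i
    unfolding has_weak_partial_def
  proof (intro conjI allI impI)
    show "(\<lambda>y. huber (u y - M)) \<in> L1_loc" using W[of i] by (simp add: has_weak_partial_def)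
    show "(\<lambda>y. 0::real) \<in> L1_loc" by (intro continuous_in_L1_loc continuous_intros)
    fix \<phi> :: "real^'n \<Rightarrow> real" assume \<phi>: "test_function \<phi>"
    have "AE y in lebesgue. F y $ i * ?\<theta> y * \<phi> y = 0"
      using AE
    proof eventually_elim
      case (elim y)
      then have "?\<theta> y = 0 \<or> F y = 0" by auto
      then show ?case by auto
    qed
    then have "(LINT y|lebesgue. F y $ i * ?\<theta> y * \<phi> y) = 0" by (rule integral_eq_zero_AE)
    then show "(LINT y|lebesgue. huber (u y - M) * partial_deriv i \<phi> y) = - (LINT y|lebesgue. 0 * \<phi> y)"
      using W[of i] \<phi> by (simp add: has_weak_partial_def)
  qed
  moreover have "continuous_on UNIV (\<lambda>y. huber (u y - M))"
    by (intro continuous_on_compose2[OF continuous_on_huber] continuous_intros u) auto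
  \<comment> \<open>Since \<open>N \<ge> 1\<close>, there is a data point \<open>x 1\<close>, where
    \<open>u \<le> M\<close> fixes the constant as 0.\<close>
  ultimately have "huber (u y - M) = huber (u (x 1) - M)" by (intro zero_weak_gradient_imp_constant) auto
  also have "\<dots> = 0" using le[of 1] N by (simp add: huber_nonpos)
  finally show ?thesis using huber_pos[of "u y - M"] by (cases "u y \<le> M") auto
qed

section \<open>Comparison with a logarithmic barrier\<close>

text \<open>Removes the singularity at \<open>y = c\<close> from \<open>ln \<bar>y - c\<bar>\<close> and \<open>\<bar>y - c\<bar>\<^bsup>-p\<^esup>\<close>, both functions of
  \<open>t = \<bar>y - c\<bar>\<^sup>2\<close>, keeping them continuously differentiable.\<close>

definition tangent_ext :: "(real \<Rightarrow> real) \<Rightarrow> (real \<Rightarrow> real) \<Rightarrow> real \<Rightarrow> real \<Rightarrow> real" where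
  "tangent_ext \<phi> \<phi>' t0 t = \<phi> (max t t0) + \<phi>' t0 * min (t - t0) 0"

lemma tangent_ext_eq: "t \<ge> t0 \<Longrightarrow> tangent_ext \<phi> \<phi>' t0 t = \<phi> t"
  by (simp add: tangent_ext_def max_absorb1)

text \<open>At \<open>t0\<close> the quotient from the left is constantly the slope of the tangent,
  and the quotient from the right tends to the same slope.\<close>

lemma DERIV_tangent_ext:
  assumes \<phi>: "\<And>t. t \<ge> t0 \<Longrightarrow> (\<phi> has_real_derivative \<phi>' t) (at t)"
  shows "(tangent_ext \<phi> \<phi>' t0 has_real_derivative \<phi>' (max t t0)) (at t)"
proof -
  consider "t > t0" | "t < t0" | "t = t0" by linarith
  then show ?thesis
  proof cases
    case 1
    have "(tangent_ext \<phi> \<phi>' t0 has_real_derivative \<phi>' t) (at t)"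
      by (rule has_field_derivative_transform_within_open[OF \<phi>, of _ "{t0<..}"])
         (use 1 in \<open>auto simp: tangent_ext_eq\<close>)
    then show ?thesis using 1 by (simp add: max_absorb1)
  next
    case 2
    have "((\<lambda>t. \<phi> t0 + \<phi>' t0 * (t - t0)) has_real_derivative \<phi>' t0) (at t)"
      by (auto intro!: derivative_eq_intros)
    then have "(tangent_ext \<phi> \<phi>' t0 has_real_derivative \<phi>' t0) (at t)"
      by (rule has_field_derivative_transform_within_open[of _ _ _ "{..<t0}"])
         (use 2 in \<open>auto simp: tangent_ext_def max_absorb2\<close>)
    then show ?thesis using 2 by (simp add: max_absorb2)
  next
    case 3
    let ?q = "\<lambda>h. (tangent_ext \<phi> \<phi>' t0 (t0 + h) - tangent_ext \<phi> \<phi>' t0 t0) / h"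
    have "((\<lambda>h. (\<phi> (t0 + h) - \<phi> t0) / h) \<longlongrightarrow> \<phi>' t0) (at_right 0)"
      using \<phi>[of t0] unfolding DERIV_def by (simp add: filterlim_at_split)
    then have "(?q \<longlongrightarrow> \<phi>' t0) (at_right 0)"
      by (rule Lim_transform_eventually)
         (rule eventually_mono[OF eventually_at_right_less], simp add: tangent_ext_eq)
    moreover have "(?q \<longlongrightarrow> \<phi>' t0) (at_left 0)"
      by (rule Lim_transform_eventually[OF tendsto_const])
         (auto simp: tangent_ext_def eventually_at_filter max_absorb2 min_absorb1)
    ultimately have "(?q \<longlongrightarrow> \<phi>' t0) (at 0)" by (simp add: filterlim_at_split)
    then show ?thesis using 3 by (simp add: DERIV_def)
  qed
qed

lemma sqnorm_diff_differentiable: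
  fixes c :: "real^'n::finite"
  shows "(\<lambda>y. (norm (y - c))\<^sup>2) differentiable (at y)"
    and "partial_deriv i (\<lambda>y. (norm (y - c))\<^sup>2) y = 2 * (y - c) $ i"
proof -
  have "((\<lambda>y. (y - c) \<bullet> (y - c)) has_derivative (\<lambda>v. 2 * ((y - c) \<bullet> v))) (at y)"
    by (auto intro!: derivative_eq_intros simp: inner_commute)
  then have D: "((\<lambda>y. (norm (y - c))\<^sup>2) has_derivative (\<lambda>v. 2 * ((y - c) \<bullet> v))) (at y)"
    by (simp add: power2_norm_eq_inner)
  then show "(\<lambda>y. (norm (y - c))\<^sup>2) differentiable (at y)" by (rule differentiableI)
  show "partial_deriv i (\<lambda>y. (norm (y - c))\<^sup>2) y = 2 * (y - c) $ i"
    by (simp add: partial_deriv_eq[OF D] inner_axis)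
qed

lemma integrable_compact_support_mult:
  fixes g \<psi> :: "real^'n::finite \<Rightarrow> real"
  assumes "g \<in> L1_loc" "\<And>x. norm x > R \<Longrightarrow> g x = 0" "continuous_on UNIV \<psi>"
  shows "integrable lebesgue (\<lambda>x. g x * \<psi> x)"
proof -
  have "(\<lambda>x. indicator (cball 0 R) x *\<^sub>R (g x * \<psi> x)) = (\<lambda>x. g x * \<psi> x)"
    using assms(2) by (auto simp: indicator_def fun_eq_iff)
  then show ?thesis
    using set_integrable_mult_continuous[OF L1_locD[OF assms(1)] _ assms(3), of "cball 0 R"]
    by (simp add: set_integrable_def)
qed

text \<open>The factor 1/2 compensates for the squared argument: at t = |y - c|^2 >= t0 the value is
  ln |y - c|.\<close>

definition log_barrier :: "real \<Rightarrow> real \<Rightarrow> real" where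
  "log_barrier t0 = tangent_ext (\<lambda>t. ln t / 2) (\<lambda>t. 1 / (2 * t)) t0"

lemma DERIV_log_barrier:
  "t0 > 0 \<Longrightarrow> (log_barrier t0 has_real_derivative 1 / (2 * max t t0)) (at t)"
  unfolding log_barrier_def by (rule DERIV_tangent_ext) (auto intro!: derivative_eq_intros)

lemma log_barrier_strict_mono: "t0 > 0 \<Longrightarrow> s < t \<Longrightarrow> log_barrier t0 s < log_barrier t0 t"
  by (rule DERIV_pos_imp_increasing) (auto intro!: exI DERIV_log_barrier)

text \<open>For \<open>h = \<kappa> + \<epsilon> ln \<bar>y - c\<bar>\<close> the field \<open>\<bar>\<nabla>h\<bar>\<^bsup>p-2\<^esup> \<nabla>h = \<epsilon>\<^bsup>p-1\<^esup> (y - c) / \<bar>y - c\<bar>\<^bsup>p\<^esup>\<close> has divergence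
  \<open>\<epsilon>\<^bsup>p-1\<^esup> (n - p) / \<bar>y - c\<bar>\<^bsup>p\<^esup>\<close>, which is negative because \<open>p > n\<close>.\<close>

lemma minimizer_le_log_barrier:
  fixes u :: "real^'n::finite \<Rightarrow> real" and c :: "real^'n"
  defines "h \<equiv> \<lambda>\<kappa> \<epsilon> t0 y. \<kappa> + \<epsilon> * log_barrier t0 ((norm (y - c))\<^sup>2)"
  assumes min: "is_minimizer p N x a u" and p: "p > real CARD('n)"
    and \<epsilon>: "\<epsilon> > 0" and t0: "t0 > 0" and R: "R \<ge> 0"
    and supp: "\<And>y. u y > h \<kappa> \<epsilon> t0 y \<Longrightarrow> (norm (y - c))\<^sup>2 \<ge> t0 \<and> norm y \<le> R"
    and le: "\<And>j. j \<in> {1..N} \<Longrightarrow> u (x j) \<le> h \<kappa> \<epsilon> t0 (x j)"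
  shows "u z \<le> h \<kappa> \<epsilon> t0 z"
proof (rule ccontr)
  assume "\<not> u z \<le> h \<kappa> \<epsilon> t0 z"
  define b where "b = h \<kappa> \<epsilon> t0"
  define q where "q y = (norm (y - c))\<^sup>2" for y
  \<comment> \<open>The gradient of the barrier \<open>b\<close>: for \<open>q y \<ge> t0\<close> it
    is \<epsilon> (y - c) / |y - c|^2.\<close>
  define H where "H y = (\<epsilon> / max (q y) t0) *\<^sub>R (y - c)" for y
  \<comment> \<open>For \<open>q y \<ge> t0\<close> this gives \<open>\<mu> (q y)\<close> = |y -
    c|^(-p), so that \<open>\<psi>\<close> is the field |H|^(p-2) H up to the factor
    \<epsilon>^(p-1).\<close>
  define \<mu> where "\<mu> = tangent_ext (\<lambda>t. t powr (- p / 2)) (\<lambda>t. (- p / 2) * t powr (- p / 2 - 1)) t0"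
  define \<psi> where "\<psi> i y = \<mu> (q y) * (y - c) $ i" for i y
  define \<theta> where "\<theta> y = clamp01 (u y - b y)" for y
  define w where "w y = huber (u y - b y)" for y
  have p1: "p \<ge> 1" "p > 0" using p zero_less_card_finite[where 'a='n] by linarith+
  have u: "continuous_on UNIV u" "u \<in> D1p p"
    using min by (auto simp: is_minimizer_def admissible_def D1p_cont_def)
  obtain F :: "real^'n \<Rightarrow> real^'n" where F: "\<And>i. has_weak_partial u i (\<lambda>x. F x $ i)"
    "integrable lebesgue (\<lambda>x. norm (F x) powr p)"
    by (rule D1p_gradient[OF u(2)]) (use p1 in auto)
  have qc: "continuous_on UNIV q" unfolding q_def by (intro continuous_intros)
  have q: "q differentiable (at y)" "partial_deriv i q y = 2 * (y - c) $ i" for y i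
    using sqnorm_diff_differentiable(1)[of c y] sqnorm_diff_differentiable(2)[of i c y] by (simp_all add: q_def[abs_def])
  have b_eq: "b = (\<lambda>y. \<kappa> + \<epsilon> * log_barrier t0 (q y))" by (simp add: b_def h_def q_def)
  have Db: "((\<lambda>t. \<kappa> + \<epsilon> * log_barrier t0 t) has_real_derivative \<epsilon> * (1 / (2 * max (q y) t0))) (at (q y))" for y
    by (auto intro!: derivative_eq_intros DERIV_log_barrier t0)
  have b: "b differentiable (at y)" "partial_deriv i b y = H y $ i" for y i
  proof -
    have "\<epsilon> * (1 / (2 * m)) * (2 * d) = \<epsilon> / m * d" for m d :: real by simp
    then show "b differentiable (at y)" "partial_deriv i b y = H y $ i" for y i
      using partial_deriv_compose(1)[OF Db q(1)] partial_deriv_compose(2)[OF Db q(1), of i y]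
      by (simp_all only: b_eq q(2) H_def vector_scaleR_component real_scaleR_def)
  qed
  have Hc: "continuous_on UNIV H" unfolding H_def by (intro continuous_intros qc) (use t0 in auto)
  have bc: "continuous_on UNIV b"
    using b(1) by (simp add: continuous_on_eq_continuous_at differentiable_imp_continuous_within)
  have bH: "has_weak_partial b i (\<lambda>y. H y $ i)" for i
    using has_weak_partial_C1[of b i] b by (simp add: b(2)[abs_def] continuous_on_component[OF Hc])
  have f: "continuous_on UNIV (\<lambda>y. u y - b y)" by (intro continuous_intros u bc)
  have \<theta>c: "continuous_on UNIV \<theta>"
    unfolding \<theta>_def by (rule continuous_on_compose2[OF continuous_on_clamp01 f]) auto
  have wc: "continuous_on UNIV w"
    unfolding w_def by (rule continuous_on_compose2[OF continuous_on_huber f]) auto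
  \<comment> \<open>Both \<open>\<theta>\<close> and \<open>w\<close> live where
    \<open>q y \<ge> t0\<close> and \<open>norm y \<le> R\<close>: the artificial extension near
    \<open>c\<close> never contributes, and all integrands below have compact support.\<close>
  have \<theta>0: "\<theta> y = 0" if "\<not> (q y \<ge> t0 \<and> norm y \<le> R)" for y
    using supp[of y] that unfolding \<theta>_def clamp01_eq_0_iff b_def q_def by force
  have w0: "w y = 0" if "\<not> (q y \<ge> t0 \<and> norm y \<le> R)" for y
    using \<theta>0[OF that] unfolding \<theta>_def clamp01_eq_0_iff w_def by (simp add: huber_nonpos)
  have \<theta>H: "integrable lebesgue (\<lambda>y. \<theta> y * norm (H y) powr p)"
    using \<theta>0 p1 by (intro integrable_compact_support_mult[where R = R] continuous_in_L1_loc \<theta>c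
        continuous_on_powr' continuous_intros Hc) auto
  note compare = minimizer_comparison[OF min p1(1) F bc bH le[folded b_def] \<theta>H[unfolded \<theta>_def], folded \<theta>_def w_def]
  define g where "g i y = (F y $ i - H y $ i) * \<theta> y" for i y
  have gW: "has_weak_partial w i (g i)" for i using compare(1) by (simp add: w_def[abs_def] g_def[abs_def] \<theta>_def)
  have gL: "g i \<in> L1_loc" for i using gW by (simp add: has_weak_partial_def)
  have g0: "g i y = 0" if "norm y > R" for i y using \<theta>0[of y] that by (simp add: g_def)
  have D\<mu>: "(\<mu> has_real_derivative (- p / 2) * (max t t0) powr (- p / 2 - 1)) (at t)" for t
    unfolding \<mu>_def by (rule DERIV_tangent_ext) (use t0 in \<open>auto intro!: derivative_eq_intros\<close>)
  have comp: "(\<lambda>y. (y - c) $ i) differentiable (at y)" "partial_deriv i (\<lambda>y. (y - c) $ i) y = 1" for i y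
  proof -
    have "((\<lambda>y. (y - c) $ i) has_derivative (\<lambda>v. v $ i)) (at y)"
      by (auto intro!: derivative_eq_intros bounded_linear.has_derivative[OF bounded_linear_vec_nth])
    then show "(\<lambda>y. (y - c) $ i) differentiable (at y)" "partial_deriv i (\<lambda>y. (y - c) $ i) y = 1"
      by (auto simp: differentiableI partial_deriv_eq)
  qed
  \<comment> \<open>The i-th derivative of the i-th component; the sum over \<open>i\<close> is the
    divergence of \<open>\<psi>\<close>.\<close>
  define \<psi>' where "\<psi>' i y = \<mu> (q y) + ((- p / 2) * (max (q y) t0) powr (- p / 2 - 1) * (2 * (y - c) $ i)) * (y - c) $ i" for i y
  have \<psi>: "\<psi> i differentiable (at y)" "partial_deriv i (\<psi> i) y = \<psi>' i y" for i y
  proof -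
    note P = partial_deriv_compose[OF D\<mu> q(1)[of y]]
    show "\<psi> i differentiable (at y)" unfolding \<psi>_def by (intro differentiable_mult P comp)
    show "partial_deriv i (\<psi> i) y = \<psi>' i y"
      using partial_deriv_mult[OF P(1) comp(1)[of i y], of i]
      unfolding \<psi>_def[abs_def] \<psi>'_def comp(2) P(2) q(2) by (simp only: mult_1_right)
  qed
  have \<mu>c: "continuous_on UNIV (\<lambda>y. \<mu> (q y))"
    by (rule continuous_on_compose2[OF _ qc, of UNIV \<mu>])
       (auto intro!: continuous_at_imp_continuous_on DERIV_isCont[OF D\<mu>])
  have \<psi>'c: "continuous_on UNIV (\<psi>' i)" for i
    unfolding \<psi>'_def by (intro continuous_intros \<mu>c qc) (use t0 in auto)
  have \<psi>c: "continuous_on UNIV (\<psi> i)" for i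
    unfolding \<psi>_def by (intro continuous_intros \<mu>c)
  have parts: "(LINT y|lebesgue. w y * \<psi>' i y) = - (LINT y|lebesgue. g i y * \<psi> i y)" for i
  proof -
    have pd: "partial_deriv i (\<psi> i) = \<psi>' i" by (rule ext) (rule \<psi>(2))
    have "(LINT y|lebesgue. w y * partial_deriv i (\<psi> i) y) = - (LINT y|lebesgue. g i y * \<psi> i y)"
      by (rule weak_integration_by_parts[OF wc gW R _ g0 \<psi>(1)]) (use w0 \<psi>'c[of i] in \<open>auto simp: pd\<close>)
    then show ?thesis by (simp only: pd)
  qed
  have intg: "integrable lebesgue (\<lambda>y. g i y * \<psi> i y)" for i
    using g0 by (intro integrable_compact_support_mult[where R = R] gL \<psi>c)
  have intw: "integrable lebesgue (\<lambda>y. w y * \<psi>' i y)" for i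
    using w0 by (intro integrable_compact_support_mult[where R = R] continuous_in_L1_loc wc \<psi>'c) auto

  \<comment> \<open>The tangent inequality at \<open>H y\<close>, evaluated at \<open>F y\<close>
    and weighted by \<open>\<theta> y\<close>; its linear term is rewritten as the product of the
    gradient \<open>g\<close> of \<open>w\<close> with the field \<open>\<psi>\<close>.\<close>
  have point: "\<theta> y * norm (H y) powr p + (p * \<epsilon> powr (p - 1)) * (\<Sum>i\<in>UNIV. g i y * \<psi> i y)
      \<le> \<theta> y * norm (F y) powr p" for y
  proof (cases "\<theta> y = 0")
    case True
    then show ?thesis by (simp add: g_def)
  next
    case False
    then have qy: "q y \<ge> t0" using \<theta>0 by blast
    then have qp: "q y > 0" using t0 by linarith
    then have yc: "norm (y - c) > 0" by (auto simp: q_def)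
    have sq: "q y = norm (y - c) powr 2" using yc by (simp add: q_def powr_numeral)
    have H0: "H y = (\<epsilon> / q y) *\<^sub>R (y - c)" using qy by (simp add: H_def max_absorb1)
    have Hn: "norm (H y) = \<epsilon> * norm (y - c) powr (-1)"
    proof -
      have "norm (H y) = \<bar>\<epsilon> / q y\<bar> * norm (y - c)" by (simp only: H0 norm_scaleR)
      also have "\<dots> = \<epsilon> * norm (y - c) powr (-1)"
        using \<epsilon> yc by (simp add: q_def power2_eq_square powr_minus divide_simps)
      finally show ?thesis .
    qed
    \<comment> \<open>Both sides equal \<epsilon>^(p-1) |y - c|^(-p).\<close>
    have "norm (H y) powr (p - 2) * (\<epsilon> / q y) = \<epsilon> powr (p - 1) * q y powr (- p / 2)"
    proof -
      have "norm (H y) powr (p - 2) = \<epsilon> powr (p - 2) * norm (y - c) powr (2 - p)"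
        by (simp only: Hn powr_mult powr_powr) simp
      moreover have "norm (y - c) powr (2 - p) / q y = norm (y - c) powr (- p)"
        by (simp only: sq powr_diff[symmetric]) simp
      moreover have "q y powr (- p / 2) = norm (y - c) powr (- p)" by (simp only: sq powr_powr) simp
      moreover have "(A * C) * (\<epsilon> / D) = (A * \<epsilon>) * (C / D)" for A C D :: real by simp
      ultimately have "norm (H y) powr (p - 2) * (\<epsilon> / q y) = (\<epsilon> powr (p - 2) * \<epsilon>) * q y powr (- p / 2)"
        by (simp only:)
      also have "\<epsilon> powr (p - 2) * \<epsilon> = \<epsilon> powr (p - 1)" using \<epsilon> by (simp add: powr_mult_base mult.commute)
      finally show ?thesis .
    qed
    moreover have \<mu>q: "\<mu> (q y) = q y powr (- p / 2)" using qy by (simp add: \<mu>_def tangent_ext_eq)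
    moreover have "(\<Sum>i\<in>UNIV. g i y * \<psi> i y) = \<theta> y * \<mu> (q y) * ((y - c) \<bullet> (F y - H y))"
      by (simp add: g_def \<psi>_def inner_vec_def sum_distrib_left algebra_simps)
    ultimately have "(p * \<epsilon> powr (p - 1)) * (\<Sum>i\<in>UNIV. g i y * \<psi> i y)
        = \<theta> y * (p * (norm (H y) powr (p - 2) * (\<epsilon> / q y)) * ((y - c) \<bullet> (F y - H y)))" by simp
    also have "\<dots> = \<theta> y * (p * norm (H y) powr (p - 2) * (H y \<bullet> (F y - H y)))" by (simp add: H0)
    finally have "\<theta> y * norm (H y) powr p + (p * \<epsilon> powr (p - 1)) * (\<Sum>i\<in>UNIV. g i y * \<psi> i y) =
        \<theta> y * (norm (H y) powr p + p * norm (H y) powr (p - 2) * (H y \<bullet> (F y - H y)))"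
      by (simp add: distrib_left)
    also have "\<dots> \<le> \<theta> y * norm (F y) powr p"
      using yc qp \<epsilon> by (intro mult_left_mono norm_powr_above_tangent p1) (auto simp: \<theta>_def clamp01_bounds H0)
    finally show ?thesis .
  qed
  \<comment> \<open>Integrating \<open>point\<close> and inserting the comparison estimate cancels
    the integral with \<open>H\<close>, so the pairing of \<open>g\<close> with
    \<open>\<psi>\<close> is nonpositive. By parts, \<open>w\<close> times the divergence of
    \<open>\<psi>\<close> has nonnegative integral.\<close>
  have "(LINT y|lebesgue. \<theta> y * norm (H y) powr p + (p * \<epsilon> powr (p - 1)) * (\<Sum>i\<in>UNIV. g i y * \<psi> i y))
      \<le> (LINT y|lebesgue. \<theta> y * norm (F y) powr p)"
    using compare(2) by (intro integral_mono point Bochner_Integration.integrable_add \<theta>H integrable_mult_right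
        Bochner_Integration.integrable_sum intg)
  also have "\<dots> \<le> (LINT y|lebesgue. \<theta> y * norm (H y) powr p)" using compare(3) .
  finally have "(p * \<epsilon> powr (p - 1)) * (\<Sum>i\<in>UNIV. LINT y|lebesgue. g i y * \<psi> i y) \<le> 0"
    using \<theta>H intg by (simp add: Bochner_Integration.integral_sum)
  then have "(\<Sum>i\<in>UNIV. LINT y|lebesgue. g i y * \<psi> i y) \<le> 0"
    using p1 \<epsilon> by (simp add: mult_le_0_iff)
  then have "(\<Sum>i\<in>UNIV. LINT y|lebesgue. w y * \<psi>' i y) \<ge> 0" by (simp add: parts sum_negf)
  then have 1: "(LINT y|lebesgue. (\<Sum>i\<in>UNIV. w y * \<psi>' i y)) \<ge> 0"
    using intw by (simp add: Bochner_Integration.integral_sum)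
  \<comment> \<open>On the support of \<open>w\<close> the divergence is (n - p)
    \<open>\<mu> (q y)\<close>: the n diagonal terms give n \<open>\<mu>\<close>, and
    differentiating \<open>\<mu>\<close> gives -p \<open>\<mu>\<close>.\<close>
  have div: "(\<Sum>i\<in>UNIV. w y * \<psi>' i y) = - (w y * ((p - real CARD('n)) * \<mu> (q y)))" for y
  proof (cases "w y = 0")
    case False
    then have qy: "q y \<ge> t0" using w0 by blast
    then have qp: "q y > 0" using t0 by linarith
    have "(\<Sum>i\<in>UNIV. ((y - c) $ i) * (y - c) $ i) = q y"
      by (simp add: q_def power2_norm_eq_inner inner_vec_def)
    moreover have "((- p / 2) * P * (2 * d)) * d = (- p * P) * (d * d)" for P d :: real by simp
    then have "\<psi>' i y = \<mu> (q y) + (- p * q y powr (- p / 2 - 1)) * ((y - c) $ i * (y - c) $ i)" for i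
      by (simp only: \<psi>'_def max_absorb1[OF qy])
    ultimately have "(\<Sum>i\<in>UNIV. \<psi>' i y) = real CARD('n) * \<mu> (q y) - p * (q y powr (- p / 2 - 1) * q y)"
      by (simp only: sum.distrib sum_distrib_left[symmetric]) simp
    also have "q y powr (- p / 2 - 1) * q y = \<mu> (q y)"
      using qp qy by (simp add: \<mu>_def tangent_ext_eq powr_mult_base mult.commute[of _ "q y"])
    finally have "(\<Sum>i\<in>UNIV. \<psi>' i y) = - ((p - real CARD('n)) * \<mu> (q y))" by (simp add: algebra_simps)
    then show ?thesis by (simp add: sum_distrib_left[symmetric])
  qed simp
  have \<mu>nn: "w y * \<mu> (q y) \<ge> 0" for y
  proof (cases "w y = 0")
    case False
    then have "q y \<ge> t0" using w0 by blast
    then show ?thesis using huber_nonneg by (simp add: w_def \<mu>_def tangent_ext_eq)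
  qed simp
  \<comment> \<open>The integrand is nonnegative as p > n, while its integral is nonpositive; so it
    vanishes at \<open>z\<close>, although all three factors are positive there.\<close>
  have "w z * ((p - real CARD('n)) * \<mu> (q z)) = 0"
  proof (rule continuous_nonneg_integral_nonpos_imp_zero[where f = "\<lambda>y. w y * ((p - real CARD('n)) * \<mu> (q y))"])
    show "continuous_on UNIV (\<lambda>y. w y * ((p - real CARD('n)) * \<mu> (q y)))" by (intro continuous_intros wc \<mu>c)
    show "integrable lebesgue (\<lambda>y. w y * ((p - real CARD('n)) * \<mu> (q y)))"
      using w0 by (intro integrable_compact_support_mult[where R = R] continuous_in_L1_loc wc continuous_intros \<mu>c) auto
    show "w y * ((p - real CARD('n)) * \<mu> (q y)) \<ge> 0" for y
      using mult_nonneg_nonneg[OF _ \<mu>nn[of y], of "p - real CARD('n)"] p by (simp add: mult.left_commute)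
    show "(LINT y|lebesgue. w y * ((p - real CARD('n)) * \<mu> (q y))) \<le> 0" using 1 by (simp add: div)
  qed
  moreover have "w z > 0" using \<open>\<not> u z \<le> h \<kappa> \<epsilon> t0 z\<close> by (simp add: w_def b_def huber_pos)
  moreover have "\<mu> (q z) > 0"
  proof -
    have "q z \<ge> t0" using w0[of z] \<open>w z > 0\<close> by force
    then show ?thesis using t0 by (simp add: \<mu>_def tangent_ext_eq)
  qed
  ultimately show False using p by simp
qed

section \<open>The strong maximum principle\<close>

text \<open>The ball is half the size of a largest ball about a point of \<open>- T\<close> near \<open>y\<^sub>0\<close>, tangent to it at \<open>z\<close>;
  halving makes \<open>z\<close> the only contact point.\<close>

lemma exists_touching_ball:
  fixes T :: "'a::euclidean_space set"
  assumes T: "closed T" "y0 \<in> T" "y0 \<notin> interior T" and r: "r > 0"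
  obtains c z where "c \<noteq> z" "z \<in> T" "dist z y0 < r" "\<And>y. y \<in> T \<Longrightarrow> dist c y \<le> dist c z \<Longrightarrow> y = z"
proof -
  have "\<not> ball y0 (r / 2) \<subseteq> T" using T(3) r by (auto simp: mem_interior)
  then obtain y1 where y1: "dist y0 y1 < r / 2" "y1 \<notin> T" by (meson mem_ball subsetI)
  obtain z where z: "z \<in> T" "\<And>y. y \<in> T \<Longrightarrow> dist y1 z \<le> dist y1 y"
    using distance_attains_inf[of T y1] T(1,2) by blast
  define c where "c = (1 / 2) *\<^sub>R (y1 + z)"
  define e where "e = z - c"
  \<comment> \<open>Relative to the midpoint \<open>c\<close>, the points \<open>y1\<close> and
    \<open>z\<close> are -e and e. For a contact point c + d, the inequalities |d| <= |e| and |2e|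
    <= |d + e| force |d - e|^2 <= 0.\<close>
  have e: "c - y1 = e" "z - y1 = 2 *\<^sub>R e" by (auto simp: e_def c_def algebra_simps scaleR_2[symmetric])
  show thesis
  proof (rule that[of c z])
    have "y1 \<noteq> z" using y1 z by auto
    then show "c \<noteq> z" using e by (auto simp: e_def)
    show "z \<in> T" by fact
    \<comment> \<open>Since \<open>z\<close> is nearest to \<open>y1\<close> and \<open>y0\<close>
      belongs to \<open>T\<close>, \<open>z\<close> is also within \<open>r / 2\<close> of
      \<open>y1\<close>.\<close>
    show "dist z y0 < r"
      using z(2)[OF T(2)] y1(1) dist_triangle[of z y0 y1] by (simp add: dist_commute)
    fix y assume y: "y \<in> T" "dist c y \<le> dist c z"
    define d where "d = y - c"
    have n1: "norm d \<le> norm e" using y(2) by (simp add: d_def e_def dist_norm norm_minus_commute)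
    have yd: "y - y1 = d + e" by (simp add: d_def e(1)[symmetric])
    have "norm (2 *\<^sub>R e) \<le> norm (d + e)"
      using z(2)[OF y(1)] unfolding dist_norm norm_minus_commute[of y1] yd e(2) .
    then have "(norm (2 *\<^sub>R e))\<^sup>2 \<le> (norm (d + e))\<^sup>2" by (rule power_mono) simp
    then have 1: "4 * (e \<bullet> e) \<le> d \<bullet> d + 2 * (d \<bullet> e) + e \<bullet> e"
      by (simp only: power2_norm_eq_inner) (simp add: algebra_simps inner_commute)
    have 2: "d \<bullet> d \<le> e \<bullet> e" using n1 by (simp add: norm_le)
    have "(d - e) \<bullet> (d - e) = d \<bullet> d - 2 * (d \<bullet> e) + e \<bullet> e"
      by (simp add: algebra_simps inner_commute)
    then have "(d - e) \<bullet> (d - e) \<le> 0" using 1 2 by linarith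
    then have "d = e" by (metis inner_ge_zero inner_eq_zero_iff antisym right_minus_eq)
    then show "y = z" by (simp add: d_def e_def)
  qed
qed

text \<open>The barrier equals \<open>M\<close> on the sphere of radius \<open>R'\<close> about
  \<open>c\<close>, is at least \<open>M\<close> outside, and is at least
  \<open>M - \<delta>\<close> everywhere. Hence \<open>u\<close> can exceed it only in
  \<open>ball z r\<close>. At \<open>z\<close> it lies strictly below \<open>M = u z\<close> because
  \<open>R < R'\<close>, contradicting \<open>minimizer_le_log_barrier\<close>.\<close>

lemma minimizer_interior_max:
  fixes u :: "real^'n::finite \<Rightarrow> real"
  assumes min: "is_minimizer p N x a u" and p: "p > real CARD('n)"
    and le: "\<And>y. u y \<le> M" and y0: "u y0 = M" "y0 \<notin> x ` {1..N}"
  shows "y0 \<in> interior {y. u y = M}"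
proof (rule ccontr)
  assume ni: "y0 \<notin> interior {y. u y = M}"
  define T where "T = {y. u y = M}"
  have u: "continuous_on UNIV u" using min by (simp add: is_minimizer_def admissible_def D1p_cont_def)
  have T: "closed T" unfolding T_def by (intro closed_Collect_eq u continuous_intros)
  have "open (- x ` {1..N})" by (intro open_Compl finite_imp_closed) auto
  then obtain r0 where r0: "r0 > 0" "ball y0 r0 \<subseteq> - x ` {1..N}" using y0(2) by (meson ComplI openE)
  obtain c z where cz: "c \<noteq> z" "z \<in> T" "dist z y0 < r0 / 2" "\<And>y. y \<in> T \<Longrightarrow> dist c y \<le> dist c z \<Longrightarrow> y = z"
    using exists_touching_ball[OF T, of y0 "r0 / 2"] y0(1) ni r0(1) by (auto simp: T_def)
  define R where "R = dist c z"
  have R: "R > 0" using cz(1) by (simp add: R_def)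
  \<comment> \<open>The bound \<open>R / 2\<close> keeps the ball around \<open>z\<close> outside
    the modified part of the barrier near \<open>c\<close>; the bound \<open>r0 / 2\<close> keeps it
    clear of the data points.\<close>
  define r where "r = min (R / 2) (r0 / 2)"
  have r: "r > 0" "r \<le> R / 2" using R r0 by (auto simp: r_def)
  have xj: "x j \<notin> ball z r" if "j \<in> {1..N}" for j
  proof
    assume "x j \<in> ball z r"
    then have "dist y0 (x j) < r0"
      using cz(3) dist_triangle[of y0 "x j" z] by (auto simp: r_def dist_commute)
    then show False using r0(2) that by auto
  qed
  \<comment> \<open>The closed set \<open>T - ball z r\<close> has a point nearest to
    \<open>c\<close>; as \<open>z\<close> is the only contact point, its distance exceeds
    \<open>R\<close>, and \<open>R'\<close> is taken halfway.\<close>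
  have "\<exists>R'>R. \<forall>y\<in>T - ball z r. R' < dist c y"
  proof (cases "T - ball z r = {}")
    case False
    obtain y where y: "y \<in> T - ball z r" "\<And>y'. y' \<in> T - ball z r \<Longrightarrow> dist c y \<le> dist c y'"
      using distance_attains_inf[of "T - ball z r" c] False T by (auto simp: closed_Diff)
    have "dist c y > R"
    proof (rule ccontr)
      assume "\<not> dist c y > R"
      then have "y = z" using y(1) by (intro cz(4)) (auto simp: R_def)
      then show False using y(1) r(1) by simp
    qed
    then show ?thesis using y(2) by (intro exI[of _ "(R + dist c y) / 2"]) force
  qed (auto intro: exI[of _ "R + 1"])
  then obtain R' where R': "R' > R" "\<And>y. y \<in> T \<Longrightarrow> y \<notin> ball z r \<Longrightarrow> R' < dist c y" by auto
  define D where "D = cball c R' - ball z r"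
  have lt: "u y < M" if "y \<in> D" for y
    using R'(2)[of y] le[of y] that by (force simp: D_def T_def less_le)
  have "\<exists>\<delta>>0. \<forall>y\<in>D. u y \<le> M - \<delta>"
  proof (cases "D = {}")
    case False
    have "compact D" unfolding D_def by (intro compact_diff) auto
    then obtain y where "y \<in> D" "\<And>y'. y' \<in> D \<Longrightarrow> u y' \<le> u y"
      using continuous_attains_sup[of D u] False continuous_on_subset[OF u] by blast
    then show ?thesis using lt[of y] by (intro exI[of _ "M - u y"]) auto
  qed (auto intro: exI[of _ 1])
  then obtain \<delta> where \<delta>: "\<delta> > 0" "\<And>y. y \<in> D \<Longrightarrow> u y \<le> M - \<delta>" by blast
  define t0 where "t0 = (R / 2)\<^sup>2"
  have t0: "t0 > 0" using R by (simp add: t0_def)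
  let ?E = "log_barrier t0"
  have mono: "?E s \<le> ?E t" if "s \<le> t" for s t
    using log_barrier_strict_mono[OF t0, of s t] that by (cases "s = t") auto
  \<comment> \<open>The oscillation of the logarithm across the ball of radius \<open>R'\<close>;
    with \<open>\<epsilon> * B = \<delta>\<close> the barrier falls at most \<open>\<delta>\<close>
    below \<open>M\<close>.\<close>
  define B where "B = ?E (R'\<^sup>2) - ?E 0"
  have B: "B > 0" using log_barrier_strict_mono[OF t0, of 0 "R'\<^sup>2"] R R'(1) by (simp add: B_def)
  define \<epsilon> where "\<epsilon> = \<delta> / B"
  have \<epsilon>: "\<epsilon> > 0" "\<epsilon> * B = \<delta>" using B \<delta> by (auto simp: \<epsilon>_def)
  \<comment> \<open>Normalises the barrier to equal \<open>M\<close> at distance \<open>R'\<close>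
    from \<open>c\<close>.\<close>
  define \<kappa> where "\<kappa> = M - \<epsilon> * ?E (R'\<^sup>2)"
  have out: "u y \<le> \<kappa> + \<epsilon> * ?E ((norm (y - c))\<^sup>2)" if y: "y \<notin> ball z r" for y
  proof (cases "y \<in> D")
    case True
    have "\<epsilon> * ?E 0 \<le> \<epsilon> * ?E ((norm (y - c))\<^sup>2)" using \<epsilon> by (intro mult_left_mono mono) auto
    moreover have "M - \<delta> = \<kappa> + \<epsilon> * ?E 0" using \<epsilon>(2) by (simp add: \<kappa>_def B_def algebra_simps)
    ultimately show ?thesis using \<delta>(2)[OF True] by linarith
  next
    case False
    then have "R' \<le> norm (y - c)" using y by (simp add: D_def dist_norm norm_minus_commute)
    then have "\<epsilon> * ?E (R'\<^sup>2) \<le> \<epsilon> * ?E ((norm (y - c))\<^sup>2)"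
      using \<epsilon> R R' by (intro mult_left_mono mono power_mono) auto
    then show ?thesis using le[of y] by (simp add: \<kappa>_def)
  qed
  have "u z \<le> \<kappa> + \<epsilon> * ?E ((norm (z - c))\<^sup>2)"
  proof (rule minimizer_le_log_barrier[OF min p \<epsilon>(1) t0, where R = "norm z + r"])
    fix y assume "\<kappa> + \<epsilon> * ?E ((norm (y - c))\<^sup>2) < u y"
    then have y: "dist z y < r" using out[of y] by force
    have "R \<le> norm (y - c) + dist z y" using dist_triangle[of c z y] by (simp add: R_def dist_norm norm_minus_commute)
    then have "R / 2 \<le> norm (y - c)" using y r by linarith
    then have "t0 \<le> (norm (y - c))\<^sup>2" unfolding t0_def using R by (intro power_mono) auto
    moreover have "norm y \<le> norm z + r" using y norm_triangle_ineq2[of y z] by (simp add: dist_norm norm_minus_commute)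
    ultimately show "t0 \<le> (norm (y - c))\<^sup>2 \<and> norm y \<le> norm z + r" ..
  qed (use r out xj in auto)
  moreover have "\<epsilon> * ?E (R\<^sup>2) < \<epsilon> * ?E (R'\<^sup>2)"
    using \<epsilon> R R' by (intro mult_strict_left_mono log_barrier_strict_mono t0 power_strict_mono) auto
  moreover have "norm (z - c) = R" by (simp add: R_def dist_norm norm_minus_commute)
  ultimately show False using cz(2) by (simp add: \<kappa>_def T_def)
qed

text \<open>The complement \<open>U\<close> of the data points is connected for n >= 2 and covered
  by the disjoint open sets \<open>interior {y. u y = M}\<close> and \<open>{y. u y < M}\<close>.
  The latter contains \<open>x k\<close> and, being open, cannot be confined to the finite set of
  data points; so it meets \<open>U\<close>, and the former does not.\<close>

lemma minimizer_less_Max: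
  fixes u :: "real^'n::finite \<Rightarrow> real"
  assumes min: "is_minimizer p N x a u" and n: "CARD('n) \<ge> 2" and p: "p > real CARD('n)"
    and M: "\<And>j. j \<in> {1..N} \<Longrightarrow> a j \<le> M" and k: "k \<in> {1..N}" "a k < M"
    and y: "y \<notin> x ` {1..N}"
  shows "u y < M"
proof -
  have u: "continuous_on UNIV u" "\<And>j. j \<in> {1..N} \<Longrightarrow> u (x j) = a j"
    using min by (auto simp: is_minimizer_def admissible_def D1p_cont_def)
  have le: "u y \<le> M" for y using n p k(1) by (intro minimizer_le_Max[OF min _ _ M]) auto
  define U where "U = UNIV - x ` {1..N}"
  have "connected U" unfolding U_def using n by (intro connected_open_delete_finite) auto
  moreover have "open {y. u y < M}" by (intro open_Collect_less u continuous_intros)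
  moreover have "U \<subseteq> interior {y. u y = M} \<union> {y. u y < M}"
    using minimizer_interior_max[OF min p le] le by (auto simp: U_def less_le)
  moreover have "interior {y. u y = M} \<inter> {y. u y < M} \<inter> U = {}" using interior_subset by fastforce
  ultimately have "interior {y. u y = M} \<inter> U = {} \<or> {y. u y < M} \<inter> U = {}"
    unfolding connected_def by (metis Un_commute open_interior)
  moreover have "{y. u y < M} \<inter> U \<noteq> {}"
  proof
    assume "{y. u y < M} \<inter> U = {}"
    then have "{y. u y < M} \<subseteq> x ` {1..N}" by (auto simp: U_def)
    then have "finite {y. u y < M}" by (rule finite_subset) simp
    then have "{y. u y < M} = {}" using \<open>open {y. u y < M}\<close> finite_imp_not_open by blast
    moreover have "x k \<in> {y. u y < M}" using u(2)[OF k(1)] k(2) by simp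
    ultimately show False by blast
  qed
  ultimately have "interior {y. u y = M} \<inter> U = {}" by blast
  then have "u y \<noteq> M" using minimizer_interior_max[OF min p le, of y] y by (auto simp: U_def)
  then show ?thesis using le[of y] by simp
qed

text \<open>Negation preserves the function class and the energy, so lower bounds follow from the
  upper bounds applied to the data \<open>- a j\<close>.\<close>

lemma minimizer_uminus:
  fixes u :: "real^'n::finite \<Rightarrow> real"
  assumes min: "is_minimizer p N x a u" and p: "p \<ge> 0"
  shows "is_minimizer p N x (\<lambda>j. - a j) (\<lambda>y. - u y)"
proof -
  have neg: "(\<lambda>y. - v y) \<in> D1p_cont p \<and> energy p (\<lambda>y. - v y) = energy p v" if "v \<in> D1p_cont p" for v :: "real^'n \<Rightarrow> real"
  proof -
    from that have v: "v \<in> D1p p" "continuous_on UNIV v" by (auto simp: D1p_cont_def)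
    obtain F :: "real^'n \<Rightarrow> real^'n" where F: "\<And>i. has_weak_partial v i (\<lambda>x. F x $ i)"
      "integrable lebesgue (\<lambda>x. norm (F x) powr p)"
      by (rule D1p_gradient[OF v(1) p]) (rule that)
    have W: "has_weak_partial (\<lambda>y. - v y) i (\<lambda>x. (- F x) $ i)" for i
      using has_weak_partial_linear[OF has_weak_partial_const F(1), where i = i and c = "-1"] by simp
    have "(\<lambda>y. - v y) \<in> D1p p" by (rule D1pI[OF W]) (use F p in auto)
    moreover have "energy p (\<lambda>y. - v y) = energy p v" by (simp add: energy_eq[OF W] energy_eq[OF F(1)])
    ultimately show ?thesis using v(2) by (auto simp: D1p_cont_def intro: continuous_intros)
  qed
  have adm: "u \<in> admissible p N x a" and opt: "\<And>v. v \<in> admissible p N x a \<Longrightarrow> energy p u \<le> energy p v"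
    using min by (auto simp: is_minimizer_def)
  show ?thesis unfolding is_minimizer_def
  proof (intro conjI ballI)
    show "(\<lambda>y. - u y) \<in> admissible p N x (\<lambda>j. - a j)" using adm neg by (auto simp: admissible_def)
    fix v assume v: "v \<in> admissible p N x (\<lambda>j. - a j)"
    then have "(\<lambda>y. - v y) \<in> admissible p N x a" using neg[of v] by (auto simp: admissible_def)
    from opt[OF this] show "energy p (\<lambda>y. - u y) \<le> energy p v"
      using neg[of u] neg[of v] adm v by (auto simp: admissible_def)
  qed
qed

theorem lemma5p4:
  fixes p :: real and N :: nat
    and x :: "nat \<Rightarrow> real^'n::finite" and a :: "nat \<Rightarrow> real"
    and u :: "real^'n \<Rightarrow> real"
  assumes "CARD('n) \<ge> 2"
    and "p > real CARD('n)"
    and "N \<ge> 1"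
    and "inj_on x {1..N}"
    and "is_minimizer p N x a u"
  shows "(\<forall>y. Min (a ` {1..N}) \<le> u y \<and> u y \<le> Max (a ` {1..N})) \<and>
    ((\<exists>i\<in>{1..N}. \<exists>j\<in>{1..N}. a i \<noteq> a j) \<longrightarrow>
      (\<forall>y. y \<notin> x ` {1..N} \<longrightarrow> Min (a ` {1..N}) < u y \<and> u y < Max (a ` {1..N})))"
proof -
  let ?m = "Min (a ` {1..N})" and ?M = "Max (a ` {1..N})"
  have p: "p \<ge> 1" "p \<ge> 0" using assms(1,2) by auto
  note neg = minimizer_uminus[OF assms(5) p(2)]
  have M: "a j \<le> ?M" and m: "- a j \<le> - ?m" if "j \<in> {1..N}" for j using that by auto
  have "?m \<le> u y \<and> u y \<le> ?M" for y
    using minimizer_le_Max[OF assms(5) p(1) assms(3) M, of y] minimizer_le_Max[OF neg p(1) assms(3) m, of y] by simp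
  moreover have "?m < u y \<and> u y < ?M"
    if ij: "i \<in> {1..N}" "j \<in> {1..N}" "a i \<noteq> a j" and y: "y \<notin> x ` {1..N}" for i j y
  proof -
    \<comment> \<open>Two different values cannot both equal the maximum; likewise below for the
      minimum.\<close>
    have "\<exists>k\<in>{1..N}. a k < ?M" using M[OF ij(1)] M[OF ij(2)] ij by (metis antisym_conv1)
    then obtain k where k: "k \<in> {1..N}" "a k < ?M" by blast
    have "\<exists>l\<in>{1..N}. - a l < - ?m" using m[OF ij(1)] m[OF ij(2)] ij by (metis antisym_conv1 neg_equal_iff_equal)
    then obtain l where l: "l \<in> {1..N}" "- a l < - ?m" by blast
    show ?thesis
      using minimizer_less_Max[OF assms(5,1,2) M k y] minimizer_less_Max[OF neg assms(1,2) m l y] by simp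
  qed
  ultimately show ?thesis by blast
qed

end
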